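(* Let $c\in C^4(\mathbb R^d\times\mathbb R^d)$ be a real-valued cost function satisfying conditions A1, A2 and weak A3 (stated in the context). Let $\mathcal U,\mathcal V\subset\mathbb R^d$ be bounded convex domains with smooth boundary such that $\mathcal U$ is $c$-convex with respect to $\mathcal V$. For distinct $y_0,y_1\in\overline{\mathcal V}$ and $a\in\mathbb R$ put $$\mathcal N(y_0,y_1,a)=\{x\in\mathbb R^d : c(x,y_0)=c(x,y_1)+a\}.$$ Assume that $\mathcal N(y_0,y_1,a)$ is convex for all distinct $y_0,y_1\in\overline{\mathcal V}$ and all $a\in\mathbb R$. Fix distinct $y_0,y_1\in\overline{\mathcal V}$ and $a\in\mathbb R$, and write $\mathcal N=\mathcal N(y_0,y_1,a)$. If $\mathcal N$ and $\partial\mathcal U$ are internally tangent at some point $z_0$, then $\mathcal U$ is inside $\mathcal N$, i.e. $\mathcal U$ is contained in the convex region bounded by $\mathcal N$.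
   Context: Subscripts $x_i$, $y_j$ on $c$ denote partial derivatives in the first and second variable; $c_x$, $c_y$ denote the gradients in the first and second variable. Conditions on $c$: - A1: for all $x,p\in\mathbb R^d$ there is a unique $y=y(x,p)\in\mathbb R^d$ with $c_x(x,y)=p$, and for all $y,q\in\mathbb R^d$ there is a unique $x=x(y,q)\in\mathbb R^d$ with $c_y(x,y)=q$. - A2: $\det\big[c_{x_i,y_j}(x,y)\big]\neq 0$ for all $x,y\in\mathbb R^d$. - Weak A3: set $A_{ij}(x,p)=c_{x_ix_j}(x,y(x,p))$, with $y(x,p)$ as in A1, and $A_{ij,kl}=\partial^2A_{ij}/\partial p_k\partial p_l$. Then for all $x,p\in\mathbb R^d$ and all $\xi,\eta\in\mathbb R^d$ with $\xi\perp\eta$, $\sum_{i,j,k,l}A_{ij,kl}(x,p)\,\xi_i\xi_j\eta_k\eta_l\ge 0$. $c$-convexity of a domain: $\mathcal U$ is $c$-convex with respect to $\mathcal V$ if for every $y\in\mathcal V$ the image $c_y(\mathcal U,y)=\{c_y(x,y):x\in\mathcal U\}$ is a convex subset of $\mathbb R^d$. Convexity of $\mathcal N$: the hypersurface $\mathcal N(y_0,y_1,a)$ (when nonempty) is called convex if it is the boundary of a convex region, this region being one of the two sides $\{x: c(x,y_0)>c(x,y_1)+a\}$, $\{x:c(x,y_0)<c(x,y_1)+a\}$ of $\mathcal N$; this region is the convex region bounded by $\mathcal N$. Outward normals: the outward unit normal of $\partial\mathcal U$ (respectively of $\mathcal N$) at a point is the unit normal pointing out of $\mathcal U$ (respectively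 out of the convex region bounded by $\mathcal N$). Internal tangency: two hypersurfaces are internally tangent at a point $z_0$ if both pass through $z_0$, they are tangent at $z_0$, and they have the same outward unit normal at $z_0$. *)

theory Defs
  imports "HOL-Analysis.Analysis"
begin

section \<open>Regularity\<close>

(* Meaningful for open S only: derivatives are taken in the full space. *)
fun C_k_on :: "nat \<Rightarrow> ('a::euclidean_space \<Rightarrow> real) \<Rightarrow> 'a set \<Rightarrow> bool" where
  "C_k_on 0 f S \<longleftrightarrow> continuous_on S f"
| "C_k_on (Suc k) f S \<longleftrightarrow>
     (\<forall>x\<in>S. f differentiable (at x)) \<and>
     (\<forall>b\<in>Basis. C_k_on k (\<lambda>x. frechet_derivative f (at x) b) S)"

(* Near each boundary point the domain D is a strict sublevel set of a smooth function with
   nonvanishing differential; in particular D lies locally on one side of its boundary, and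
   the boundary is locally the zero set of that function. *)
definition smooth_boundary :: "'a::euclidean_space set \<Rightarrow> bool" where
  "smooth_boundary D \<longleftrightarrow>
     (\<forall>z\<in>frontier D. \<exists>W \<rho>. open W \<and> z \<in> W \<and> (\<forall>k. C_k_on k \<rho> W) \<and>
        frechet_derivative \<rho> (at z) \<noteq> (\<lambda>_. 0) \<and>
        D \<inter> W = {x\<in>W. \<rho> x < 0})"

section \<open>Partial derivatives and the conditions on the cost\<close>

definition partial :: "'n \<Rightarrow> (real^'n \<Rightarrow> real) \<Rightarrow> real^'n \<Rightarrow> real" where
  "partial i f x = deriv (\<lambda>t. f (x + t *\<^sub>R axis i 1)) 0"

definition grad :: "(real^'n \<Rightarrow> real) \<Rightarrow> real^'n \<Rightarrow> real^'n" where
  "grad f x = (\<chi> i. partial i f x)"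

definition grad_x :: "(real^'n \<Rightarrow> real^'n \<Rightarrow> real) \<Rightarrow> real^'n \<Rightarrow> real^'n \<Rightarrow> real^'n" where
  "grad_x c x y = grad (\<lambda>x'. c x' y) x"

definition grad_y :: "(real^'n \<Rightarrow> real^'n \<Rightarrow> real) \<Rightarrow> real^'n \<Rightarrow> real^'n \<Rightarrow> real^'n" where
  "grad_y c x y = grad (\<lambda>y'. c x y') y"

definition A1 :: "(real^'n \<Rightarrow> real^'n \<Rightarrow> real) \<Rightarrow> bool" where
  "A1 c \<longleftrightarrow> (\<forall>x p. \<exists>!y. grad_x c x y = p) \<and> (\<forall>y q. \<exists>!x. grad_y c x y = q)"

definition A2 :: "(real^'n \<Rightarrow> real^'n \<Rightarrow> real) \<Rightarrow> bool" where
  "A2 c \<longleftrightarrow>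
     (\<forall>x y. det (\<chi> i j. partial j (\<lambda>y'. partial i (\<lambda>x'. c x' y') x) y) \<noteq> 0)"

(* Specified only under A1. *)
definition y_of :: "(real^'n \<Rightarrow> real^'n \<Rightarrow> real) \<Rightarrow> real^'n \<Rightarrow> real^'n \<Rightarrow> real^'n" where
  "y_of c x p = (THE y. grad_x c x y = p)"

(* The second x-derivatives are taken with the second argument frozen; y_of is substituted
   afterwards. *)
definition A_mat ::
    "(real^'n \<Rightarrow> real^'n \<Rightarrow> real) \<Rightarrow> 'n \<Rightarrow> 'n \<Rightarrow> real^'n \<Rightarrow> real^'n \<Rightarrow> real" where
  "A_mat c i j x p =
     (let y = y_of c x p in partial j (\<lambda>x'. partial i (\<lambda>x''. c x'' y) x') x)"

definition weak_A3 :: "(real^'n \<Rightarrow> real^'n \<Rightarrow> real) \<Rightarrow> bool" where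
  "weak_A3 c \<longleftrightarrow>
     (\<forall>x p \<xi> \<eta>. orthogonal \<xi> \<eta> \<longrightarrow>
        (\<Sum>i\<in>UNIV. \<Sum>j\<in>UNIV. \<Sum>k\<in>UNIV. \<Sum>l\<in>UNIV.
           partial k (\<lambda>p'. partial l (A_mat c i j x) p') p * \<xi>$i * \<xi>$j * \<eta>$k * \<eta>$l) \<ge> 0)"

definition c_convex_wrt ::
    "(real^'n \<Rightarrow> real^'n \<Rightarrow> real) \<Rightarrow> (real^'n) set \<Rightarrow> (real^'n) set \<Rightarrow> bool" where
  "c_convex_wrt c U V \<longleftrightarrow> (\<forall>y\<in>V. convex ((\<lambda>x. grad_y c x y) ` U))"

section \<open>The hypersurfaces\<close>

definition N_surf ::
    "(real^'n \<Rightarrow> real^'n \<Rightarrow> real) \<Rightarrow> real^'n \<Rightarrow> real^'n \<Rightarrow> real \<Rightarrow> (real^'n) set" where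
  "N_surf c y0 y1 a = {x. c x y0 = c x y1 + a}"

(* A relation, not a function: if N is a hyperplane, both sides qualify. *)
definition convex_region_of_N ::
    "(real^'n \<Rightarrow> real^'n \<Rightarrow> real) \<Rightarrow> real^'n \<Rightarrow> real^'n \<Rightarrow> real \<Rightarrow> (real^'n) set \<Rightarrow> bool" where
  "convex_region_of_N c y0 y1 a R \<longleftrightarrow>
     (R = {x. c x y0 > c x y1 + a} \<or> R = {x. c x y0 < c x y1 + a}) \<and>
     convex R \<and> frontier R = N_surf c y0 y1 a"

definition N_convex ::
    "(real^'n \<Rightarrow> real^'n \<Rightarrow> real) \<Rightarrow> real^'n \<Rightarrow> real^'n \<Rightarrow> real \<Rightarrow> bool" where
  "N_convex c y0 y1 a \<longleftrightarrow> (\<exists>R. convex_region_of_N c y0 y1 a R)"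

section \<open>Normals and tangency\<close>

(* Velocities of curves in S through z. The curves need only be differentiable at time 0; on a
   hypersurface of class C^1 this gives the usual tangent space. *)
definition tangent_space :: "'a::euclidean_space set \<Rightarrow> 'a \<Rightarrow> 'a set" where
  "tangent_space S z =
     {v. \<exists>\<gamma>::real \<Rightarrow> 'a. \<gamma> 0 = z \<and> (\<forall>t. \<gamma> t \<in> S) \<and> (\<gamma> has_vector_derivative v) (at 0)}"

(* S is the hypersurface, D the region it bounds. *)
definition outward_unit_normal ::
    "'a::euclidean_space set \<Rightarrow> 'a set \<Rightarrow> 'a \<Rightarrow> 'a \<Rightarrow> bool" where
  "outward_unit_normal S D z \<nu> \<longleftrightarrow>
     norm \<nu> = 1 \<and> (\<forall>v\<in>tangent_space S z. orthogonal \<nu> v) \<and>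
     (\<forall>\<^sub>F t in at_right 0. z + t *\<^sub>R \<nu> \<notin> closure D)"

definition internally_tangent ::
    "'a::euclidean_space set \<Rightarrow> 'a set \<Rightarrow> 'a set \<Rightarrow> 'a set \<Rightarrow> 'a \<Rightarrow> bool" where
  "internally_tangent S D S' D' z \<longleftrightarrow>
     z \<in> S \<and> z \<in> S' \<and> tangent_space S z = tangent_space S' z \<and>
     (\<exists>\<nu>. outward_unit_normal S D z \<nu> \<and> outward_unit_normal S' D' z \<nu>)"

end

theory Submission
  imports Defs
begin

text \<open>
  Say the region is \<open>{h < 0}\<close> with \<open>h x = c x y0 - c x y1 - a\<close>, and let \<open>\<gamma>\<close> be the
  \<open>c\<close>-segment from \<open>y1\<close> to \<open>y0\<close> based at \<open>z0\<close>, along which \<open>grad_x c z0 (\<gamma> t)\<close> is affine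
  in \<open>t\<close>. Since \<open>c_y(U, y0)\<close> is convex, it has a supporting functional at \<open>c_y(z0, y0)\<close>;
  by internal tangency this functional is a positive multiple of \<open>\<gamma>' 1\<close>. Hence for \<open>x \<in> U\<close> the
  function \<open>g t = c x (\<gamma> t) - c z0 (\<gamma> t)\<close> satisfies \<open>g' 1 \<le> 0\<close>. Weak A3 gives
  \<open>g'' t \<ge> 0\<close> whenever \<open>g' t = 0\<close>, so \<open>g' \<le> 0\<close> on all of \<open>[0, 1]\<close>, and \<open>g 1 \<le> g 0\<close> says
  \<open>h x \<le> 0\<close>. The inequality is strict on the open set \<open>U\<close> because \<open>h\<close> has no critical points.
\<close>

section \<open>Iterated directional derivatives\<close>

text \<open>Weak A3 is infinitesimal, while the sign of \<open>g''\<close> compares two possibly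
  distant points x and z0. The bridge is a second c-segment, now in the first variable and taken
  with respect to \<gamma> t, joining z0 to x. Where \<open>g' t = 0\<close>, its velocity satisfies
  the orthogonality required by weak A3 at every point, so that weak A3 becomes convexity of one
  function along it. This rests on a symmetry of the curvature expression under exchange of the two
  variables, which consumes all four derivatives of c. The inequality \<open>g'' t \<ge> 0\<close>
  at zeros of \<open>g'\<close> is not strict and does not by itself exclude a downward sign change;
  a perturbation of x restores strictness. As y0 may lie on the boundary of V, where c-convexity is
  not assumed, the supporting functional at y0 is a limit of functionals at points of V. Finally,
  the iterated partial derivatives in weak A3 can be handled only once y(x, p) is known to be twice
  differentiable in p, hence the section on inverses.\<close>

definition dird :: "'a::euclidean_space \<Rightarrow> ('a \<Rightarrow> real) \<Rightarrow> 'a \<Rightarrow> real" where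
  "dird v f z = frechet_derivative f (at z) v"

lemma C_k_on_SucI:
  assumes "\<And>z. f differentiable (at z)" "\<And>b. b \<in> Basis \<Longrightarrow> C_k_on k (dird b f) UNIV"
  shows "C_k_on (Suc k) f UNIV"
  using assms by (simp add: dird_def[abs_def])

lemma C_k_on_Suc_differentiable: "C_k_on (Suc k) f UNIV \<Longrightarrow> f differentiable (at z)"
  by simp

lemma C_k_on_Suc_dird_Basis:
  "C_k_on (Suc k) f UNIV \<Longrightarrow> b \<in> Basis \<Longrightarrow> C_k_on k (dird b f) UNIV"
  by (simp add: dird_def[abs_def])

lemma has_derivative_dird:
  "f differentiable (at z) \<Longrightarrow> (f has_derivative (\<lambda>v. dird v f z)) (at z)"
  unfolding dird_def by (simp flip: frechet_derivative_works)

lemma dird_eq: "(f has_derivative f') (at z) \<Longrightarrow> dird v f z = f' v"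
  by (simp add: dird_def frechet_derivative_at[symmetric])

lemma linear_dird: "f differentiable (at z) \<Longrightarrow> linear (\<lambda>v. dird v f z)"
  using has_derivative_dird has_derivative_linear by blast

lemma dird_add_left:
  "f differentiable (at z) \<Longrightarrow> dird (u + v) f z = dird u f z + dird v f z"
  using linear_add[OF linear_dird] .

lemma dird_scale_left: "f differentiable (at z) \<Longrightarrow> dird (r *\<^sub>R v) f z = r * dird v f z"
  using linear_cmul[OF linear_dird] by simp

lemma dird_sum_left:
  "f differentiable (at z) \<Longrightarrow> dird (\<Sum>i\<in>I. r i *\<^sub>R v i) f z = (\<Sum>i\<in>I. r i * dird (v i) f z)"
  by (simp add: linear_sum[OF linear_dird] dird_scale_left)

lemma dird_Basis:
  "f differentiable (at z) \<Longrightarrow> dird v f z = (\<Sum>b\<in>Basis. (v \<bullet> b) * dird b f z)"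
  by (subst (1) euclidean_representation[symmetric], subst dird_sum_left) auto

lemma dird_sum_right:
  assumes "\<And>i. i \<in> I \<Longrightarrow> f i differentiable (at z)"
  shows "dird v (\<lambda>x. \<Sum>i\<in>I. r i * f i x) z = (\<Sum>i\<in>I. r i * dird v (f i) z)"
proof -
  have "((\<lambda>x. \<Sum>i\<in>I. r i * f i x) has_derivative (\<lambda>v. \<Sum>i\<in>I. r i * dird v (f i) z)) (at z)"
    by (intro has_derivative_sum has_derivative_mult_right has_derivative_dird assms)
  then show ?thesis by (rule dird_eq)
qed

lemma C_k_on_sum:
  fixes f :: "'i \<Rightarrow> 'a::euclidean_space \<Rightarrow> real"
  assumes "\<And>i. i \<in> I \<Longrightarrow> C_k_on k (f i) UNIV"
  shows "C_k_on k (\<lambda>x. \<Sum>i\<in>I. r i * f i x) UNIV"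
  using assms
proof (induction k arbitrary: f)
  case 0
  then show ?case by (auto intro!: continuous_intros)
next
  case (Suc k)
  show ?case
  proof (rule C_k_on_SucI)
    fix z
    show "(\<lambda>x. \<Sum>i\<in>I. r i * f i x) differentiable at z"
    proof (cases "finite I")
      case True
      then show ?thesis
        using Suc.prems by (intro differentiable_sum differentiable_mult) auto
    qed simp
  next
    fix b :: 'a assume b: "b \<in> Basis"
    have "dird b (\<lambda>x. \<Sum>i\<in>I. r i * f i x) = (\<lambda>z. \<Sum>i\<in>I. r i * dird b (f i) z)"
      using Suc.prems by (intro ext dird_sum_right) auto
    then show "C_k_on k (dird b (\<lambda>x. \<Sum>i\<in>I. r i * f i x)) UNIV"
      using Suc.IH[of "\<lambda>i. dird b (f i)"] C_k_on_Suc_dird_Basis[OF Suc.prems b] by simp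
  qed
qed

text \<open>\<open>C_k_on\<close> speaks of basis directions only; a derivative in any fixed
  direction is a linear combination of those with constant coefficients.\<close>

lemma C_k_on_dird: "C_k_on (Suc k) f UNIV \<Longrightarrow> C_k_on k (dird v f) UNIV"
proof -
  assume f: "C_k_on (Suc k) f UNIV"
  have "dird v f = (\<lambda>z. \<Sum>b\<in>Basis. (v \<bullet> b) * dird b f z)"
    using f by (intro ext dird_Basis) auto
  then show ?thesis
    using C_k_on_sum[of Basis k "\<lambda>b. dird b f" "\<lambda>b. v \<bullet> b"] C_k_on_Suc_dird_Basis[OF f] by simp
qed

lemma C_k_on_Suc_imp: "C_k_on (Suc k) f UNIV \<Longrightarrow> C_k_on k f UNIV"
proof (induction k arbitrary: f)
  case 0
  then show ?case
    by (simp add: continuous_on_eq_continuous_within differentiable_imp_continuous_within)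
next
  case (Suc k)
  show ?case
  proof (rule C_k_on_SucI)
    show "f differentiable (at z)" for z
      using Suc.prems by (rule C_k_on_Suc_differentiable)
    show "C_k_on k (dird b f) UNIV" if "b \<in> Basis" for b
      using Suc.prems that by (intro Suc.IH C_k_on_Suc_dird_Basis)
  qed
qed

lemma C_k_on_mono: "C_k_on m f UNIV \<Longrightarrow> k \<le> m \<Longrightarrow> C_k_on k f UNIV"
proof (induction m)
  case (Suc m)
  then show ?case using C_k_on_Suc_imp[of m f] by (cases "k = Suc m") auto
qed simp

lemma C_k_on_continuous: "C_k_on k f UNIV \<Longrightarrow> continuous_on UNIV f"
  using C_k_on_mono[of k f 0] by simp

lemma has_real_derivative_along:
  assumes "f differentiable (at (\<gamma> t))" "(\<gamma> has_vector_derivative \<gamma>') (at t)"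
  shows "((\<lambda>t. f (\<gamma> t)) has_real_derivative dird \<gamma>' f (\<gamma> t)) (at t)"
proof -
  have "((\<lambda>t. f (\<gamma> t)) has_derivative (\<lambda>s. dird (s *\<^sub>R \<gamma>') f (\<gamma> t))) (at t)"
    using has_derivative_compose[OF assms(2)[unfolded has_vector_derivative_def]
        has_derivative_dird[OF assms(1)]] .
  then show ?thesis
    unfolding has_field_derivative_def
    by (rule has_derivative_eq_rhs) (auto simp: dird_scale_left[OF assms(1)])
qed

text \<open>The direction \<open>w t\<close> moves together with the base point. Expanding it in the
  basis separates the two dependences, and the product rule applies to each summand.\<close>

lemma has_real_derivative_dird_along:
  assumes f: "C_k_on 2 f UNIV"
    and \<gamma>: "(\<gamma> has_vector_derivative \<gamma>') (at t)" and w: "(w has_vector_derivative w') (at t)"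
  shows "((\<lambda>t. dird (w t) f (\<gamma> t)) has_real_derivative
          dird \<gamma>' (dird (w t) f) (\<gamma> t) + dird w' f (\<gamma> t)) (at t)"
proof -
  have f': "C_k_on (Suc 1) f UNIV" using f by (simp add: numeral_2_eq_2)
  have d: "f differentiable (at z)" for z using f' by auto
  have d2: "dird v f differentiable (at z)" for v z
    using C_k_on_dird[OF f'] by auto
  have wb: "((\<lambda>t. w t \<bullet> b) has_real_derivative w' \<bullet> b) (at t)" for b
    using w unfolding has_vector_derivative_def has_field_derivative_def
    by (auto intro!: derivative_eq_intros simp: mult.commute)
  have e: "dird v f z = (\<Sum>b\<in>Basis. (v \<bullet> b) * dird b f z)" for v z
    using dird_Basis[OF d] .
  have "((\<lambda>t. \<Sum>b\<in>Basis. (w t \<bullet> b) * dird b f (\<gamma> t)) has_real_derivative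
      (\<Sum>b\<in>Basis. (w' \<bullet> b) * dird b f (\<gamma> t) + dird \<gamma>' (dird b f) (\<gamma> t) * (w t \<bullet> b))) (at t)"
    by (intro DERIV_sum DERIV_mult wb has_real_derivative_along d2 \<gamma>)
  moreover have "dird \<gamma>' (dird (w t) f) (\<gamma> t) = (\<Sum>b\<in>Basis. (w t \<bullet> b) * dird \<gamma>' (dird b f) (\<gamma> t))"
  proof -
    have "dird (w t) f = (\<lambda>z. \<Sum>b\<in>Basis. (w t \<bullet> b) * dird b f z)" by (intro ext e)
    then show ?thesis by (simp add: dird_sum_right d2)
  qed
  ultimately show ?thesis
    by (simp add: e[of "w _"] e[of w'] sum.distrib algebra_simps)
qed

lemma has_vector_derivative_line:
  "((\<lambda>t. p + t *\<^sub>R q) has_vector_derivative q) (at s)"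
  by (auto intro!: derivative_eq_intros)

lemma has_vector_derivative_Pair_const:
  assumes "(\<gamma> has_vector_derivative v) (at t)"
  shows "((\<lambda>t. (x, \<gamma> t)) has_vector_derivative (0, v)) (at t)"
    and "((\<lambda>t. (\<gamma> t, x)) has_vector_derivative (v, 0)) (at t)"
  by (intro has_vector_derivative_Pair has_vector_derivative_const assms)+

section \<open>Symmetry of second derivatives\<close>

lemma dird_second_difference:
  assumes f: "C_k_on 2 f UNIV" and "t > 0"
  shows "\<exists>a\<in>{0..t}. \<exists>b\<in>{0..t}. f (z + t *\<^sub>R u + t *\<^sub>R v) - f (z + t *\<^sub>R u) - f (z + t *\<^sub>R v) + f z
           = t\<^sup>2 * dird v (dird u f) (z + a *\<^sub>R u + b *\<^sub>R v)"
proof -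
  have f': "C_k_on (Suc 1) f UNIV" using f by (simp add: numeral_2_eq_2)
  have d: "f differentiable (at z)" for z using f' by auto
  have d2: "dird v f differentiable (at z)" for v z
    using C_k_on_dird[OF f'] by auto
  have lin: "((\<lambda>s. p + s *\<^sub>R q) has_vector_derivative q) (at s)" for p q :: 'a and s
    by (auto intro!: derivative_eq_intros)
  have "((\<lambda>s. f ((z + t *\<^sub>R v) + s *\<^sub>R u) - f (z + s *\<^sub>R u)) has_real_derivative
          dird u f ((z + t *\<^sub>R v) + s *\<^sub>R u) - dird u f (z + s *\<^sub>R u)) (at s)" for s
    by (intro DERIV_diff has_real_derivative_along d lin)
  from MVT2[OF \<open>t > 0\<close> this] obtain a where a: "0 < a" "a < t"
    "f ((z + t *\<^sub>R v) + t *\<^sub>R u) - f (z + t *\<^sub>R u) - (f (z + t *\<^sub>R v) - f z)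
      = t * (dird u f ((z + t *\<^sub>R v) + a *\<^sub>R u) - dird u f (z + a *\<^sub>R u))"
    by auto
  have "((\<lambda>s. dird u f ((z + a *\<^sub>R u) + s *\<^sub>R v)) has_real_derivative
          dird v (dird u f) ((z + a *\<^sub>R u) + s *\<^sub>R v)) (at s)" for s
    by (intro has_real_derivative_along d2 lin)
  from MVT2[OF \<open>t > 0\<close> this] obtain b where b: "0 < b" "b < t"
    "dird u f ((z + a *\<^sub>R u) + t *\<^sub>R v) - dird u f (z + a *\<^sub>R u)
      = t * dird v (dird u f) ((z + a *\<^sub>R u) + b *\<^sub>R v)"
    by auto
  show ?thesis
    using a b by (intro bexI[of _ a] bexI[of _ b]) (auto simp: algebra_simps power2_eq_square)
qed

text \<open>The second difference is symmetric in u and v, and after division by the squared step it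
  converges to either mixed derivative, depending on the order in which the mean value theorem is
  applied.\<close>

lemma dird_commute:
  assumes f: "C_k_on 2 f UNIV"
  shows "dird u (dird v f) z = dird v (dird u f) z"
proof -
  have f': "C_k_on (Suc (Suc 0)) f UNIV" using f by (simp add: numeral_2_eq_2)
  have c: "continuous_on UNIV (dird u (dird v f))" for u v
    using C_k_on_dird[OF C_k_on_dird[OF f']] by simp
  define t :: "nat \<Rightarrow> real" where "t n = inverse (real (Suc n))" for n
  have t0: "t \<longlonglongrightarrow> 0" unfolding t_def by (rule LIMSEQ_inverse_real_of_nat)
  have tp: "t n > 0" for n by (simp add: t_def)
  have "\<forall>n. \<exists>a b. 0 \<le> a \<and> a \<le> t n \<and> 0 \<le> b \<and> b \<le> t n \<and>
      f (z + t n *\<^sub>R u + t n *\<^sub>R v) - f (z + t n *\<^sub>R u) - f (z + t n *\<^sub>R v) + f z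
       = (t n)\<^sup>2 * dird v (dird u f) (z + a *\<^sub>R u + b *\<^sub>R v)" for u v
    using dird_second_difference[OF f tp, of _ z u v] by (meson atLeastAtMost_iff)
  then have ex: "\<exists>a b. \<forall>n. 0 \<le> a n \<and> a n \<le> t n \<and> 0 \<le> b n \<and> b n \<le> t n \<and>
      f (z + t n *\<^sub>R u + t n *\<^sub>R v) - f (z + t n *\<^sub>R u) - f (z + t n *\<^sub>R v) + f z
       = (t n)\<^sup>2 * dird v (dird u f) (z + a n *\<^sub>R u + b n *\<^sub>R v)" for u v
    by metis
  have lim: "(\<lambda>n. (f (z + t n *\<^sub>R u + t n *\<^sub>R v) - f (z + t n *\<^sub>R u) - f (z + t n *\<^sub>R v) + f z) / (t n)\<^sup>2)
      \<longlonglongrightarrow> dird v (dird u f) z" for u v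
  proof -
    obtain a b where ab: "\<And>n. 0 \<le> a n" "\<And>n. a n \<le> t n" "\<And>n. 0 \<le> b n" "\<And>n. b n \<le> t n"
      "\<And>n. f (z + t n *\<^sub>R u + t n *\<^sub>R v) - f (z + t n *\<^sub>R u) - f (z + t n *\<^sub>R v) + f z
       = (t n)\<^sup>2 * dird v (dird u f) (z + a n *\<^sub>R u + b n *\<^sub>R v)"
      using ex[of u v] by metis
    have a0: "a \<longlonglongrightarrow> 0" and b0: "b \<longlonglongrightarrow> 0"
      by (rule tendsto_sandwich[OF _ _ tendsto_const t0]; simp add: ab)+
    have "(\<lambda>n. z + a n *\<^sub>R u + b n *\<^sub>R v) \<longlonglongrightarrow> z + 0 *\<^sub>R u + 0 *\<^sub>R v"
      by (intro tendsto_intros a0 b0)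
    then have "(\<lambda>n. dird v (dird u f) (z + a n *\<^sub>R u + b n *\<^sub>R v)) \<longlonglongrightarrow> dird v (dird u f) z"
      using continuous_on_tendsto_compose[OF c[of v u]] by simp
    moreover have "t n \<noteq> 0" for n using tp[of n] by simp
    ultimately show ?thesis by (simp add: ab(5))
  qed
  show ?thesis
    by (rule LIMSEQ_unique[OF lim[of v u]], rule Lim_transform_eventually[OF lim[of u v]])
      (simp add: add_ac diff_diff_add)
qed

section \<open>Inverses of differentiable bijections\<close>

text \<open>No continuity of \<open>P'\<close> is assumed: in finite dimension, a continuous
  injection on an open set whose derivative at a point is invertible has a differentiable inverse at
  the image point.\<close>

lemma has_derivative_inv_bij:
  fixes P :: "'a::euclidean_space \<Rightarrow> 'a"
  assumes "bij P" and P': "\<And>y. (P has_derivative P' y) (at y)" and "\<And>y. inj (P' y)"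
  shows "(inv P has_derivative inv (P' (inv P p))) (at p)"
proof -
  have lin: "linear (P' y)" for y by (rule has_derivative_linear[OF P'])
  have "surj (P' y)" for y
    by (intro linear_injective_imp_surjective lin assms(3) refl)
  then have id: "P' (inv P p) \<circ> inv (P' (inv P p)) = id"
    by (simp add: surj_iff)
  have "continuous_on UNIV P"
    by (intro continuous_at_imp_continuous_on ballI has_derivative_continuous[OF P'])
  then have "(inv P has_derivative inv (P' (inv P p))) (at (P (inv P p)))"
    using \<open>bij P\<close> by (intro has_derivative_inverse_strong[OF open_UNIV UNIV_I _ _ P' id])
      (auto simp: bij_def)
  then show ?thesis
    using \<open>bij P\<close> by (simp add: bij_def surj_f_inv_f)
qed

text \<open>The derivative of the inverse is read off the inverse of the tangent map
  \<open>(y, w) \<mapsto> (P y, P' y w)\<close>, which satisfies the same hypotheses as \<open>P\<close>.\<close>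

lemma inv_derivative_differentiable:
  fixes P :: "'a::euclidean_space \<Rightarrow> 'a"
  assumes "bij P" and P': "\<And>y. (P has_derivative P' y) (at y)" and inj: "\<And>y. inj (P' y)"
    and diff: "\<And>v y. (\<lambda>y. P' y v) differentiable (at y)"
  shows "(\<lambda>p. inv (P' (inv P p)) v) differentiable (at p)"
proof -
  have lin: "linear (P' y)" for y by (rule has_derivative_linear[OF P'])
  have surj: "surj (P' y)" for y
    by (intro linear_injective_imp_surjective lin inj refl)
  define D where "D y v = frechet_derivative (\<lambda>y. P' y v) (at y)" for y v
  have D: "((\<lambda>y. P' y v) has_derivative D y v) (at y)" for y v
    using diff D_def frechet_derivative_works by metis
  have rep: "P' y w = (\<Sum>b\<in>Basis. (w \<bullet> b) *\<^sub>R P' y b)" for y w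
    by (subst euclidean_representation[of w, symmetric])
      (simp add: linear_sum[OF lin] linear_cmul[OF lin] del: euclidean_representation)
  \<comment> \<open>The hypothesis \<open>diff\<close> concerns \<open>P' y v\<close> for fixed v
    only. Expanding the second component in the basis makes joint differentiability in (y, w) a
    matter of sums and products.\<close>
  define T where "T z = (P (fst z), \<Sum>b\<in>Basis. (snd z \<bullet> b) *\<^sub>R P' (fst z) b)" for z
  have T: "T (y, w) = (P y, P' y w)" for y w
    by (simp add: T_def rep[of y w])
  define T' where "T' z h = (P' (fst z) (fst h),
      \<Sum>b\<in>Basis. (snd z \<bullet> b) *\<^sub>R D (fst z) b (fst h) + (snd h \<bullet> b) *\<^sub>R P' (fst z) b)" for z h
  have "(T has_derivative T' z) (at z)" for z
  proof -
    have "((\<lambda>z. P' (fst z) b) has_derivative (\<lambda>h. D (fst z) b (fst h))) (at z)" for b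
      by (rule has_derivative_compose[OF has_derivative_fst[OF has_derivative_ident] D])
    moreover have "((\<lambda>z. P (fst z)) has_derivative (\<lambda>h. P' (fst z) (fst h))) (at z)"
      by (rule has_derivative_compose[OF has_derivative_fst[OF has_derivative_ident] P'])
    ultimately show ?thesis
      unfolding T_def[abs_def] T'_def[abs_def]
      by (auto intro!: derivative_eq_intros)
  qed
  \<comment> \<open>\<open>T' z\<close> is block triangular with \<open>P' (fst z)\<close> in both
    diagonal blocks.\<close>
  moreover have "inj (T' z)" for z
  proof -
    have linT: "linear (T' z)"
      using calculation has_derivative_linear by blast
    have "h = 0" if "T' z h = 0" for h
    proof -
      have 1: "P' (fst z) (fst h) = 0" using that by (simp add: T'_def zero_prod_def)
      then have a: "fst h = 0"
        using inj[of "fst z"] linear_injective_0[OF lin] by blast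
      have "linear (D (fst z) b)" for b by (rule has_derivative_linear[OF D])
      then have "D (fst z) b 0 = 0" for b using linear_0 by blast
      then have "P' (fst z) (snd h) = 0"
        using that a rep[of "fst z" "snd h"] by (simp add: T'_def zero_prod_def)
      then have "snd h = 0"
        using inj[of "fst z"] linear_injective_0[OF lin] by blast
      with a show ?thesis by (simp add: prod_eq_iff)
    qed
    then show ?thesis using linear_injective_0[OF linT] by blast
  qed
  moreover have bijT: "bij T"
  proof (rule bijI)
    show "inj T"
    proof (rule injI)
      fix z z' assume "T z = T z'"
      then have "P (fst z) = P (fst z')" "P' (fst z) (snd z) = P' (fst z') (snd z')"
        using T[of "fst z" "snd z"] T[of "fst z'" "snd z'"] by auto
      moreover from this(1) have 1: "fst z = fst z'"
        by (rule injD[OF bij_is_inj[OF \<open>bij P\<close>]])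
      ultimately have "snd z = snd z'"
        by (simp add: inj_eq[OF inj])
      with 1 show "z = z'" by (rule prod_eqI)
    qed
    have "T (inv P p, inv (P' (inv P p)) v) = (p, v)" for p v
      using \<open>bij P\<close> surj by (simp add: T bij_def surj_f_inv_f)
    then show "surj T" by (metis surj_def surj_pair)
  qed
  ultimately have "(inv T has_derivative inv (T' (inv T (p, v)))) (at (p, v))"
    by (intro has_derivative_inv_bij)
  then have "(\<lambda>z. snd (inv T z)) differentiable (at (p, v))"
    using has_derivative_snd differentiableI by blast
  then have "(\<lambda>p. snd (inv T (p, v))) differentiable (at p)"
    using differentiable_chain_at[of "\<lambda>p. (p, v)" p "\<lambda>z. snd (inv T z)"]
    by (simp add: o_def differentiable_Pair)
  moreover have "snd (inv T (p, v)) = inv (P' (inv P p)) v" for p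
  proof -
    have "inv T (p, v) = (inv P p, inv (P' (inv P p)) v)"
      using bijT \<open>bij P\<close> surj
      by (intro inv_f_eq) (auto simp: T bij_def surj_f_inv_f)
    then show ?thesis by simp
  qed
  ultimately show ?thesis by simp
qed

lemma has_vector_derivative_on_line:
  assumes "\<And>p. (f has_derivative f' p) (at p)"
  shows "((\<lambda>t. f (p + t *\<^sub>R v)) has_vector_derivative f' (p + t *\<^sub>R v) v) (at t)"
proof -
  have "((\<lambda>t. f (p + t *\<^sub>R v)) has_derivative (\<lambda>s. f' (p + t *\<^sub>R v) (s *\<^sub>R v))) (at t)"
    by (rule has_derivative_compose[OF _ assms]) (auto intro!: derivative_eq_intros)
  then show ?thesis
    unfolding has_vector_derivative_def
    using linear_cmul[OF has_derivative_linear[OF assms]] by simp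
qed

text \<open>With P a partial gradient of the cost, these curves are the c-segments. Two derivatives
  are recorded because second derivatives of functions will be taken along them.\<close>

lemma preimage_of_line:
  fixes P :: "'a::euclidean_space \<Rightarrow> 'a"
  assumes "bij P" and P': "\<And>y. (P has_derivative P' y) (at y)" and inj: "\<And>y. inj (P' y)"
    and diff: "\<And>v y. (\<lambda>y. P' y v) differentiable (at y)"
  shows "\<exists>\<gamma> \<gamma>' \<gamma>''. (\<forall>t. P (\<gamma> t) = p + t *\<^sub>R v) \<and>
      (\<forall>t. (\<gamma> has_vector_derivative \<gamma>' t) (at t)) \<and>
      (\<forall>t. (\<gamma>' has_vector_derivative \<gamma>'' t) (at t))"
proof -
  let ?Q' = "\<lambda>p. inv (P' (inv P p))"
  have 1: "(inv P has_derivative ?Q' p) (at p)" for p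
    by (rule has_derivative_inv_bij[OF assms(1-3)])
  have 2: "((\<lambda>p. ?Q' p v) has_derivative frechet_derivative (\<lambda>p. ?Q' p v) (at p)) (at p)" for p
    using inv_derivative_differentiable[OF assms] by (simp only: frechet_derivative_works)
  have "P (inv P (p + t *\<^sub>R v)) = p + t *\<^sub>R v" for t
    by (simp add: bij_is_surj[OF \<open>bij P\<close>] surj_f_inv_f)
  moreover note has_vector_derivative_on_line[where f = "inv P" and f' = ?Q' and v = v, OF 1]
  moreover note has_vector_derivative_on_line[where f = "\<lambda>p. ?Q' p v" and v = v, OF 2]
  ultimately show ?thesis
    by (intro exI[of _ "\<lambda>t. inv P (p + t *\<^sub>R v)"] exI[of _ "\<lambda>t. ?Q' (p + t *\<^sub>R v) v"]
        exI[of _ "\<lambda>t. frechet_derivative (\<lambda>p. ?Q' p v) (at (p + t *\<^sub>R v)) v"]) blast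
qed

section \<open>Partial derivatives\<close>

lemma sum_axis_scaleR: "(\<Sum>i\<in>UNIV. v $ i *\<^sub>R axis i 1) = (v::real^'n)"
  using basis_expansion[of v] by (simp add: scalar_mult_eq_scaleR)

lemma sum_axis_Pair_0: "(\<Sum>i\<in>UNIV. v $ i *\<^sub>R (axis i 1, 0::real^'m)) = (v::real^'n, 0)"
  by (simp add: sum_prod sum_axis_scaleR)

lemma sum_0_Pair_axis: "(\<Sum>i\<in>UNIV. v $ i *\<^sub>R (0::real^'m, axis i 1)) = (0, v::real^'n)"
  by (simp add: sum_prod sum_axis_scaleR)

lemma dird_eq_deriv:
  assumes "f differentiable (at z)"
  shows "deriv (\<lambda>t. f (z + t *\<^sub>R v)) 0 = dird v f z"
  using has_real_derivative_along[OF _ has_vector_derivative_line, of f z 0 v] assms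
  by (intro DERIV_imp_deriv) simp

lemma partial_eq_dird: "G differentiable (at p) \<Longrightarrow> partial k G p = dird (axis k 1) G p"
  unfolding partial_def by (rule dird_eq_deriv)

lemma partial_fst_eq_dird:
  "f differentiable (at (x, y)) \<Longrightarrow> partial k (\<lambda>x. f (x, y)) x = dird (axis k 1, 0) f (x, y)"
  using dird_eq_deriv[of f "(x, y)" "(axis k 1, 0)"] by (simp add: partial_def)

lemma partial_snd_eq_dird:
  "f differentiable (at (x, y)) \<Longrightarrow> partial k (\<lambda>y. f (x, y)) y = dird (0, axis k 1) f (x, y)"
  using dird_eq_deriv[of f "(x, y)" "(0, axis k 1)"] by (simp add: partial_def)

text \<open>Replaces the coordinate form of the Hessian in weak A3 by an iterated directional
  derivative, which can be computed along a curve.\<close>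

lemma sum_second_partials:
  assumes G: "\<And>p. G differentiable (at p)" and G': "\<And>v p. dird v G differentiable (at p)"
  shows "(\<Sum>k\<in>UNIV. \<Sum>l\<in>UNIV. partial k (\<lambda>p. partial l G p) p * (\<eta> $ k * \<eta> $ l))
    = dird \<eta> (dird \<eta> G) p"
proof -
  have "partial k (\<lambda>p. partial l G p) p = dird (axis k 1) (dird (axis l 1) G) p" for k l
    using partial_eq_dird[OF G] partial_eq_dird[OF G'] by simp
  moreover have "dird \<eta> G = (\<lambda>p. \<Sum>l\<in>UNIV. \<eta> $ l * dird (axis l 1) G p)"
    by (intro ext, subst sum_axis_scaleR[of \<eta>, symmetric]) (rule dird_sum_left[OF G])
  then have "dird \<eta> (dird \<eta> G) p = (\<Sum>l\<in>UNIV. \<eta> $ l * dird \<eta> (dird (axis l 1) G) p)"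
    by (simp add: dird_sum_right G')
  moreover have "dird \<eta> (dird (axis l 1) G) p
      = (\<Sum>k\<in>UNIV. \<eta> $ k * dird (axis k 1) (dird (axis l 1) G) p)" for l
    by (subst sum_axis_scaleR[of \<eta>, symmetric]) (rule dird_sum_left[OF G'])
  ultimately show ?thesis
    by (subst sum.swap) (simp add: sum_distrib_left mult_ac)
qed

lemma has_derivative_vec:
  assumes "\<And>i. ((\<lambda>x. f x $ i) has_derivative (\<lambda>h. f' h $ i)) (at x)"
  shows "((f :: 'a::real_normed_vector \<Rightarrow> real^'n) has_derivative f') (at x)"
proof -
  have "((\<lambda>x. f x \<bullet> b) has_derivative (\<lambda>x. f' x \<bullet> b)) (at x)" if b: "b \<in> Basis" for b
  proof -
    obtain i where "b = axis i 1" using b unfolding Basis_vec_def by auto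
    then show ?thesis using assms[of i] by (simp only: inner_axis inner_real_def mult_1_right)
  qed
  then show ?thesis
    using has_derivative_componentwise_within[of f f' x UNIV] by blast
qed

section \<open>Functions along curves\<close>

lemma affine_along:
  assumes f: "C_k_on 2 f UNIV"
    and z: "\<And>t. (z has_vector_derivative w t) (at t)"
    and w: "\<And>t. (w has_vector_derivative w' t) (at t)"
    and affine: "\<And>t. f (z t) = \<alpha> + t * \<beta>"
  shows "dird (w t) f (z t) = \<beta>"
    and "dird (w t) (dird (w t) f) (z t) + dird (w' t) f (z t) = 0"
proof -
  have df: "f differentiable (at p)" for p
    using f unfolding numeral_2_eq_2 by (rule C_k_on_Suc_differentiable)
  have 1: "dird (w t) f (z t) = \<beta>" for t
  proof (rule DERIV_unique)
    show "((\<lambda>t. f (z t)) has_real_derivative dird (w t) f (z t)) (at t)"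
      by (rule has_real_derivative_along[OF df z])
    show "((\<lambda>t. f (z t)) has_real_derivative \<beta>) (at t)"
      unfolding affine by (auto intro!: derivative_eq_intros)
  qed
  then show "dird (w t) f (z t) = \<beta>" .
  show "dird (w t) (dird (w t) f) (z t) + dird (w' t) f (z t) = 0"
  proof (rule DERIV_unique)
    show "((\<lambda>t. dird (w t) f (z t)) has_real_derivative
        dird (w t) (dird (w t) f) (z t) + dird (w' t) f (z t)) (at t)"
      by (rule has_real_derivative_dird_along[OF f z w])
    show "((\<lambda>t. dird (w t) f (z t)) has_real_derivative 0) (at t)"
      unfolding 1 by simp
  qed
qed

text \<open>At the first point where f stops being positive it vanishes, and a positive derivative
  there would force negative values just before.\<close>

lemma first_zero_nonpos_deriv:
  fixes f :: "real \<Rightarrow> real"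
  assumes "a < b" and f': "\<And>t. (f has_real_derivative f' t) (at t)"
    and "f a > 0" and "f b \<le> 0"
  shows "\<exists>t\<in>{a..b}. f t = 0 \<and> f' t \<le> 0"
proof -
  have cont: "isCont f t" for t using f' by (rule DERIV_isCont)
  let ?Z = "{t\<in>{a..b}. f t \<le> 0}"
  have "closed ?Z"
  proof -
    have "?Z = {a..b} \<inter> {t. f t \<le> 0}" by auto
    then show ?thesis
      using cont by (auto intro!: closed_Int closed_Collect_le continuous_on_const
          continuous_at_imp_continuous_on)
  qed
  moreover have "?Z \<noteq> {}" using assms by force
  moreover have "bdd_below ?Z" by (rule bdd_belowI[of _ a]) auto
  ultimately have Inf: "Inf ?Z \<in> ?Z" by (intro closed_contains_Inf)
  define t where "t = Inf ?Z"
  have t: "a \<le> t" "t \<le> b" "f t \<le> 0" using Inf unfolding t_def by auto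
  have pos: "f s > 0" if "a \<le> s" "s < t" for s
  proof (rule ccontr)
    assume "\<not> f s > 0"
    then have "s \<in> ?Z" using that t by auto
    then have "t \<le> s" unfolding t_def by (rule cInf_lower) (rule \<open>bdd_below ?Z\<close>)
    with that show False by simp
  qed
  have "f t = 0"
  proof -
    obtain s where "a \<le> s" "s \<le> t" "f s = 0"
      using IVT2[of f t 0 a] t \<open>f a > 0\<close> cont by auto
    then show ?thesis using pos[of s] by (cases "s = t") auto
  qed
  moreover have "f' t \<le> 0"
  proof (rule ccontr)
    assume "\<not> f' t \<le> 0"
    then obtain d where d: "d > 0" "\<And>h. 0 < h \<Longrightarrow> h < d \<Longrightarrow> f (t - h) < f t"
      using DERIV_pos_inc_left[OF f'[of t]] by auto
    have "a < t" using t \<open>f a > 0\<close> by (cases "a = t") auto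
    define h where "h = min (d/2) (t - a)"
    have "0 < h" "h < d" "a \<le> t - h" using \<open>a < t\<close> d(1) by (auto simp: h_def)
    then show False using d(2)[of h] pos[of "t - h"] \<open>f t = 0\<close> by simp
  qed
  ultimately show ?thesis using t by auto
qed

text \<open>Joint continuity, with both directions moving along with the point, is what allows a
  compactness argument on a whole time interval later; the basis expansion reduces it to fixed
  directions.\<close>

lemma continuous_on_dird_dird:
  assumes f: "C_k_on 2 f UNIV"
    and u: "continuous_on S u" and w: "continuous_on S w" and z: "continuous_on S z"
  shows "continuous_on S (\<lambda>p. dird (u p) (dird (w p) f) (z p))"
proof -
  have f': "C_k_on (Suc (Suc 0)) f UNIV" using f by (simp only: numeral_2_eq_2)
  have df: "f differentiable (at z)" for z
    using f' by (rule C_k_on_Suc_differentiable)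
  have d2: "dird v f differentiable (at z)" for v z
    using C_k_on_dird[OF f'] by (rule C_k_on_Suc_differentiable)
  have c: "continuous_on UNIV (dird v (dird v' f))" for v v'
    using C_k_on_dird[OF C_k_on_dird[OF f']] by (rule C_k_on_continuous)
  have 1: "dird v f = (\<lambda>z. \<Sum>b\<in>Basis. (v \<bullet> b) * dird b f z)" for v
    by (rule ext) (rule dird_Basis[OF df])
  have 2: "dird v (dird v' f) z
      = (\<Sum>b\<in>Basis. (v' \<bullet> b) * (\<Sum>b'\<in>Basis. (v \<bullet> b') * dird b' (dird b f) z))" for v v' z
    unfolding dird_Basis[OF d2, of v, symmetric]
    by (subst 1) (rule dird_sum_right[OF d2])
  have 3: "(\<lambda>p. dird (u p) (dird (w p) f) (z p)) = (\<lambda>p. \<Sum>b\<in>Basis. (w p \<bullet> b) *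
      (\<Sum>b'\<in>Basis. (u p \<bullet> b') * dird b' (dird b f) (z p)))"
    by (rule ext) (rule 2)
  show ?thesis
    unfolding 3
    by (intro continuous_on_sum continuous_on_mult continuous_on_inner continuous_on_const u w
        continuous_on_compose2[OF c z] subset_UNIV)
qed

section \<open>Tangent spaces\<close>

lemma eventually_less_in_direction:
  fixes f :: "'a::real_normed_vector \<Rightarrow> real"
  assumes f: "(f has_derivative f') (at z)" and "f' v < 0"
  shows "\<forall>\<^sub>F t in at_right 0. f (z + t *\<^sub>R v) < f z"
proof -
  have "((\<lambda>t. f (z + t *\<^sub>R v)) has_derivative (\<lambda>s. f' (s *\<^sub>R v))) (at 0)"
    by (rule has_derivative_compose[where g = f and f = "\<lambda>t. z + t *\<^sub>R v"])
      (auto intro!: derivative_eq_intros f)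
  then have "((\<lambda>t. f (z + t *\<^sub>R v)) has_real_derivative f' v) (at 0)"
    unfolding has_field_derivative_def
    by (rule has_derivative_eq_rhs) (simp add: fun_eq_iff linear_cmul[OF has_derivative_linear[OF f]])
  from DERIV_neg_dec_right[OF this \<open>f' v < 0\<close>] obtain d
    where "d > 0" "\<And>h. 0 < h \<Longrightarrow> h < d \<Longrightarrow> f (z + h *\<^sub>R v) < f z" by auto
  then show ?thesis unfolding eventually_at_right_field by auto
qed

lemma eventually_in_direction:
  fixes z v :: "'a::real_normed_vector"
  assumes "open W" "z \<in> W"
  shows "\<forall>\<^sub>F t in at_right 0. z + t *\<^sub>R v \<in> W"
proof -
  have "((\<lambda>t. z + t *\<^sub>R v) \<longlongrightarrow> z + 0 *\<^sub>R v) (at_right 0)"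
    by (intro tendsto_intros)
  then show ?thesis using assms by (intro topological_tendstoD) auto
qed

text \<open>Along a curve in S through z the function has a local maximum at time 0. The
  neighbourhood W is there for functions controlled only near z, such as a local defining function
  of the boundary.\<close>

lemma tangent_space_local_max:
  fixes f :: "'a::euclidean_space \<Rightarrow> real"
  assumes f: "(f has_derivative f') (at z)" and W: "open W" "z \<in> W"
    and max: "\<And>x. x \<in> S \<Longrightarrow> x \<in> W \<Longrightarrow> f x \<le> f z" and "v \<in> tangent_space S z"
  shows "f' v = 0"
proof -
  obtain \<gamma> where \<gamma>: "\<gamma> 0 = z" "\<And>t. \<gamma> t \<in> S" "(\<gamma> has_vector_derivative v) (at 0)"
    using assms(5) by (auto simp: tangent_space_def)
  have "((\<lambda>t. f (\<gamma> t)) has_derivative (\<lambda>s. f' (s *\<^sub>R v))) (at 0)"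
    using \<gamma>(1) f by (intro has_derivative_compose[OF \<gamma>(3)[unfolded has_vector_derivative_def]]) simp
  then have d: "((\<lambda>t. f (\<gamma> t)) has_real_derivative f' v) (at 0)"
    unfolding has_field_derivative_def
    by (rule has_derivative_eq_rhs) (simp add: fun_eq_iff linear_cmul[OF has_derivative_linear[OF f]])
  have "(\<gamma> \<longlongrightarrow> \<gamma> 0) (at 0)"
    using has_vector_derivative_continuous[OF \<gamma>(3)] by (simp add: continuous_at)
  then have "\<forall>\<^sub>F t in at 0. \<gamma> t \<in> W"
    using W \<gamma>(1) by (intro topological_tendstoD) auto
  then obtain \<delta> where "\<delta> > 0" "\<And>t. t \<noteq> 0 \<Longrightarrow> \<bar>t\<bar> < \<delta> \<Longrightarrow> \<gamma> t \<in> W"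
    by (auto simp: eventually_at dist_real_def)
  then have "f (\<gamma> t) \<le> f (\<gamma> 0)" if "\<bar>0 - t\<bar> < \<delta>" for t
    using max[OF \<gamma>(2)[of t]] \<gamma>(1) that by (cases "t = 0") auto
  then show ?thesis using DERIV_local_max[OF d \<open>\<delta> > 0\<close>] by blast
qed

text \<open>Since a curve in \<open>tangent_space\<close> has to be differentiable at time 0 only,
  no implicit function theorem is needed: the line \<open>z + t *\<^sub>R v\<close> is corrected in
  direction \<eta> by a root of h, and the correction is o(t).\<close>

lemma tangent_space_level_set:
  fixes h :: "'a::euclidean_space \<Rightarrow> real"
  assumes cont: "continuous_on UNIV h" and h: "(h has_derivative (\<lambda>v. \<eta> \<bullet> v)) (at z)"
    and "h z = 0" "\<eta> \<noteq> 0" and orth: "\<eta> \<bullet> v = 0"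
  shows "v \<in> tangent_space {x. h x = 0} z"
proof -
  define Z where "Z t = {s. h (z + t *\<^sub>R v + s *\<^sub>R \<eta>) = 0}" for t
  have "closed (Z t)" for t
    unfolding Z_def
    by (intro closed_Collect_eq continuous_on_compose2[OF cont] continuous_intros subset_UNIV)
  then have "\<exists>s\<in>Z t. \<forall>s'\<in>Z t. dist 0 s \<le> dist 0 s'" if "Z t \<noteq> {}" for t
    using distance_attains_inf[of "Z t" 0] that by metis
  \<comment> \<open>A root of least modulus is chosen, so that exhibiting any small root bounds
    \<theta> t. No regularity of \<theta> away from t = 0 is required; where no root exists,
    \<gamma> t falls back to z, which still lies in the level set.\<close>
  then obtain \<theta> where \<theta>: "\<And>t. Z t \<noteq> {} \<Longrightarrow> \<theta> t \<in> Z t"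
    and min: "\<And>t s'. s' \<in> Z t \<Longrightarrow> \<bar>\<theta> t\<bar> \<le> \<bar>s'\<bar>"
    by (simp add: dist_real_def) (metis empty_iff)
  define \<gamma> where "\<gamma> t = (if Z t = {} then z else z + t *\<^sub>R v + \<theta> t *\<^sub>R \<eta>)" for t
  have "\<gamma> t \<in> {x. h x = 0}" for t
    using \<theta>[of t] \<open>h z = 0\<close> by (auto simp: \<gamma>_def Z_def)
  moreover have \<gamma>0: "\<gamma> 0 = z"
  proof -
    have "0 \<in> Z 0" using \<open>h z = 0\<close> by (simp add: Z_def)
    then show ?thesis using min[of 0 0] by (auto simp: \<gamma>_def)
  qed
  moreover have "(\<gamma> has_vector_derivative v) (at 0)"
    unfolding has_vector_derivative_def has_derivative_at_alt
  proof (intro conjI allI impI)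
    show "bounded_linear (\<lambda>s. s *\<^sub>R v)" by (rule bounded_linear_scaleR_left)
  next
    fix e :: real assume "e > 0"
    define \<epsilon> where "\<epsilon> = e / norm \<eta>"
    have "norm \<eta> > 0" using \<open>\<eta> \<noteq> 0\<close> by simp
    then have \<epsilon>: "\<epsilon> > 0" "\<epsilon> * norm \<eta> = e" using \<open>e > 0\<close> by (auto simp: \<epsilon>_def)
    define K where "K = norm v + e"
    have "K > 0" using \<open>e > 0\<close> by (simp add: K_def add_nonneg_pos)
    \<comment> \<open>K bounds the displacement per unit of |t| when |s| is at most
      \<open>\<epsilon> * \<bar>t\<bar>\<close>. The tolerance is set so that the linearisation
      error is then at most the linear term at s =
      \<open>\<epsilon> * \<bar>t\<bar>\<close>.\<close>
    define e' where "e' = \<epsilon> * (\<eta> \<bullet> \<eta>) / K"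
    have "e' > 0" using \<epsilon> \<open>K > 0\<close> \<open>\<eta> \<noteq> 0\<close> by (simp add: e'_def)
    then obtain \<delta> where "\<delta> > 0"
      and \<delta>: "\<And>y. norm (y - z) < \<delta> \<Longrightarrow> norm (h y - h z - \<eta> \<bullet> (y - z)) \<le> e' * norm (y - z)"
      using h unfolding has_derivative_at_alt by meson
    show "\<exists>d>0. \<forall>t. norm (t - 0) < d \<longrightarrow> norm (\<gamma> t - \<gamma> 0 - (t - 0) *\<^sub>R v) \<le> e * norm (t - 0)"
    proof (intro exI[of _ "\<delta> / K"] conjI allI impI)
      show "\<delta> / K > 0" using \<open>\<delta> > 0\<close> \<open>K > 0\<close> by simp
      fix t :: real assume "norm (t - 0) < \<delta> / K"
      then have t: "\<bar>t\<bar> * K < \<delta>" using \<open>K > 0\<close> by (simp add: field_simps)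
      let ?k = "\<lambda>s. t *\<^sub>R v + s *\<^sub>R \<eta>"
      have bound: "\<bar>h (z + ?k s) - s * (\<eta> \<bullet> \<eta>)\<bar> \<le> \<epsilon> * \<bar>t\<bar> * (\<eta> \<bullet> \<eta>)" if s: "\<bar>s\<bar> \<le> \<epsilon> * \<bar>t\<bar>" for s
      proof -
        have "norm (?k s) \<le> \<bar>t\<bar> * norm v + \<bar>s\<bar> * norm \<eta>"
          by (rule norm_triangle_le) simp
        also have "\<bar>s\<bar> * norm \<eta> \<le> \<epsilon> * \<bar>t\<bar> * norm \<eta>"
          using s by (rule mult_right_mono) simp
        also have "\<bar>t\<bar> * norm v + \<epsilon> * \<bar>t\<bar> * norm \<eta> = \<bar>t\<bar> * K"
          using \<epsilon>(2) by (simp add: K_def algebra_simps)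
        finally have k: "norm (?k s) \<le> \<bar>t\<bar> * K" by simp
        have "\<bar>h (z + ?k s) - s * (\<eta> \<bullet> \<eta>)\<bar> \<le> e' * norm (?k s)"
          using \<delta>[of "z + ?k s"] k t \<open>h z = 0\<close> orth by (simp add: inner_add_right add.assoc)
        also have "\<dots> \<le> e' * (\<bar>t\<bar> * K)"
          using k \<open>e' > 0\<close> by (intro mult_left_mono) auto
        also have "\<dots> = \<epsilon> * \<bar>t\<bar> * (\<eta> \<bullet> \<eta>)"
          using \<open>K > 0\<close> by (simp add: e'_def)
        finally show ?thesis .
      qed
      define r where "r = \<epsilon> * \<bar>t\<bar>"
      have "r \<ge> 0" using \<epsilon> by (simp add: r_def)
      \<comment> \<open>At both ends the linear term dominates the error, so h changes sign and has
        a root of modulus at most r.\<close>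
      have "h (z + ?k (- r)) \<le> 0" "0 \<le> h (z + ?k r)"
        using bound[of r] bound[of "- r"] \<open>r \<ge> 0\<close> by (simp_all add: r_def[symmetric] abs_le_iff)
      moreover have "continuous_on {- r..r} (\<lambda>s. h (z + ?k s))"
        by (intro continuous_on_compose2[OF cont] continuous_intros subset_UNIV)
      ultimately obtain s where s: "- r \<le> s" "s \<le> r" "h (z + ?k s) = 0"
        using IVT'[of "\<lambda>s. h (z + ?k s)" "- r" 0 r] \<open>r \<ge> 0\<close> by auto
      then have "s \<in> Z t" by (simp add: Z_def add.assoc)
      then have "\<bar>\<theta> t\<bar> \<le> r" using min[of s t] s by linarith
      moreover have "\<gamma> t - \<gamma> 0 - (t - 0) *\<^sub>R v = \<theta> t *\<^sub>R \<eta>"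
        using \<open>s \<in> Z t\<close> \<gamma>0 by (auto simp: \<gamma>_def[of t])
      ultimately have "norm (\<gamma> t - \<gamma> 0 - (t - 0) *\<^sub>R v) \<le> r * norm \<eta>"
        by (simp add: mult_right_mono)
      also have "r * norm \<eta> = e * norm (t - 0)"
        using \<epsilon>(2) by (simp add: r_def mult_ac)
      finally show "norm (\<gamma> t - \<gamma> 0 - (t - 0) *\<^sub>R v) \<le> e * norm (t - 0)" .
    qed
  qed
  ultimately show ?thesis unfolding tangent_space_def by blast
qed

lemma linear_functional_kernel:
  fixes f :: "'a::euclidean_space \<Rightarrow> real"
  assumes "linear f" and "\<eta> \<noteq> 0" and ker: "\<And>v. \<eta> \<bullet> v = 0 \<Longrightarrow> f v = 0"
  shows "f v = (\<eta> \<bullet> v) / (\<eta> \<bullet> \<eta>) * f \<eta>"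
proof -
  have "\<eta> \<bullet> (v - ((\<eta> \<bullet> v) / (\<eta> \<bullet> \<eta>)) *\<^sub>R \<eta>) = 0"
    using \<open>\<eta> \<noteq> 0\<close> by (simp add: inner_diff_right)
  from ker[OF this] show ?thesis
    using \<open>linear f\<close> by (simp add: linear_diff linear_cmul)
qed

section \<open>Costs satisfying A1 and A2\<close>

locale smooth_cost =
  fixes c :: "real^'n \<Rightarrow> real^'n \<Rightarrow> real"
  assumes C4: "C_k_on 4 (\<lambda>(x, y). c x y) UNIV" and A1: "A1 c" and A2: "A2 c"
begin

text \<open>After uncurrying, partial derivatives in either variable are directional derivatives of
  one function, with directions (v, 0) and (0, v), and every exchange of x- and y-derivatives is an
  instance of \<open>dird_commute\<close>.\<close>

definition F :: "(real^'n) \<times> (real^'n) \<Rightarrow> real" where "F = (\<lambda>(x, y). c x y)"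

lemma F_Pair: "F (x, y) = c x y"
  by (simp add: F_def)

lemma C_F: "k \<le> 4 \<Longrightarrow> C_k_on k F UNIV"
  using C_k_on_mono[OF C4] by (simp add: F_def)

lemma C_dF: "k \<le> 3 \<Longrightarrow> C_k_on k (dird u F) UNIV"
  by (intro C_k_on_dird C_F) simp

lemma C_ddF: "k \<le> 2 \<Longrightarrow> C_k_on k (dird u (dird v F)) UNIV"
  by (intro C_k_on_dird C_dF) simp

lemma C_dddF: "k \<le> 1 \<Longrightarrow> C_k_on k (dird u (dird v (dird w F))) UNIV"
  by (intro C_k_on_dird C_ddF) simp

lemma differentiable_F: "F differentiable (at z)"
  by (rule C_k_on_Suc_differentiable[of 0]) (rule C_F, simp)

lemma differentiable_dF: "dird u F differentiable (at z)"
  by (rule C_k_on_Suc_differentiable[of 0]) (rule C_dF, simp)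

lemma differentiable_ddF: "dird u (dird v F) differentiable (at z)"
  by (rule C_k_on_Suc_differentiable[of 0]) (rule C_ddF, simp)

lemma differentiable_dddF: "dird u (dird v (dird w F)) differentiable (at z)"
  by (rule C_k_on_Suc_differentiable[of 0]) (rule C_dddF, simp)

lemma grad_x_nth: "grad_x c x y $ i = dird (axis i 1, 0) F (x, y)"
  unfolding grad_x_def grad_def
  using partial_fst_eq_dird[OF differentiable_F] by (simp add: F_Pair)

lemma grad_y_nth: "grad_y c x y $ i = dird (0, axis i 1) F (x, y)"
  unfolding grad_y_def grad_def
  using partial_snd_eq_dird[OF differentiable_F] by (simp add: F_Pair)

lemma inner_grad_x: "grad_x c x y \<bullet> v = dird (v, 0) F (x, y)"
proof -
  have "dird (v, 0) F (x, y) = (\<Sum>i\<in>UNIV. v $ i * dird (axis i 1, 0) F (x, y))"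
    by (subst sum_axis_Pair_0[of v, symmetric]) (rule dird_sum_left[OF differentiable_F])
  then show ?thesis
    by (simp add: inner_vec_def grad_x_nth mult.commute)
qed

lemma inner_grad_y: "grad_y c x y \<bullet> v = dird (0, v) F (x, y)"
proof -
  have "dird (0, v) F (x, y) = (\<Sum>i\<in>UNIV. v $ i * dird (0, axis i 1) F (x, y))"
    by (subst sum_0_Pair_axis[of v, symmetric]) (rule dird_sum_left[OF differentiable_F])
  then show ?thesis
    by (simp add: inner_vec_def grad_y_nth mult.commute)
qed

lemma bij_grad_x: "bij (grad_x c x)"
  using A1 unfolding A1_def bij_iff by simp

lemma bij_grad_y: "bij (\<lambda>x. grad_y c x y)"
  using A1 unfolding A1_def bij_iff by simp

lemma y_of_eq: "y_of c x p = inv (grad_x c x) p"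
proof -
  have "\<exists>!y. grad_x c x y = p" using A1 by (simp add: A1_def)
  moreover have "grad_x c x (inv (grad_x c x) p) = p"
    using bij_grad_x[of x] by (simp add: bij_def surj_f_inv_f)
  ultimately show ?thesis unfolding y_of_def by (rule the1_equality)
qed

section \<open>The mixed Hessian as the derivative of both partial gradients\<close>

definition mixed_hessian :: "real^'n \<Rightarrow> real^'n \<Rightarrow> real^'n^'n" where
  "mixed_hessian x y = (\<chi> i j. dird (0, axis j 1) (dird (axis i 1, 0) F) (x, y))"

lemma det_mixed_hessian: "det (mixed_hessian x y) \<noteq> 0"
proof -
  have "partial i (\<lambda>x'. c x' y') x = dird (axis i 1, 0) F (x, y')" for i y'
    using partial_fst_eq_dird[OF differentiable_F] by (simp add: F_Pair)
  then have "partial j (\<lambda>y'. partial i (\<lambda>x'. c x' y') x) y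
      = dird (0, axis j 1) (dird (axis i 1, 0) F) (x, y)" for i j
    using partial_snd_eq_dird[OF differentiable_dF] by simp
  moreover have "det (\<chi> i j. partial j (\<lambda>y'. partial i (\<lambda>x'. c x' y') x) y) \<noteq> 0"
    using A2 unfolding A2_def by blast
  ultimately show ?thesis by (simp add: mixed_hessian_def)
qed

lemma mixed_hessian_mult: "(mixed_hessian x y *v \<zeta>) $ i = dird (0, \<zeta>) (dird (axis i 1, 0) F) (x, y)"
proof -
  have "dird (0, \<zeta>) (dird (axis i 1, 0) F) (x, y)
      = (\<Sum>j\<in>UNIV. \<zeta> $ j * dird (0, axis j 1) (dird (axis i 1, 0) F) (x, y))"
    by (subst sum_0_Pair_axis[of \<zeta>, symmetric]) (rule dird_sum_left[OF differentiable_dF])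
  then show ?thesis
    by (simp add: mixed_hessian_def matrix_vector_mult_def mult.commute)
qed

lemma dird_commute_F: "dird u (dird v F) z = dird v (dird u F) z"
  by (rule dird_commute, rule C_F, simp)

lemma mixed_hessian_transpose_mult: "(transpose (mixed_hessian x y) *v \<xi>) $ i = dird (\<xi>, 0) (dird (0, axis i 1) F) (x, y)"
proof -
  have "dird (\<xi>, 0) (dird (0, axis i 1) F) (x, y)
      = (\<Sum>j\<in>UNIV. \<xi> $ j * dird (axis j 1, 0) (dird (0, axis i 1) F) (x, y))"
    by (subst sum_axis_Pair_0[of \<xi>, symmetric]) (rule dird_sum_left[OF differentiable_dF])
  also have "\<dots> = (\<Sum>j\<in>UNIV. \<xi> $ j * dird (0, axis i 1) (dird (axis j 1, 0) F) (x, y))"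
    by (intro sum.cong arg_cong2[of _ _ _ _ "(*)"] dird_commute_F refl)
  finally show ?thesis
    by (simp add: mixed_hessian_def matrix_vector_mult_def transpose_def mult.commute del: transpose_matrix_vector)
qed

definition grad_x' :: "real^'n \<Rightarrow> real^'n \<Rightarrow> real^'n \<Rightarrow> real^'n" where
  "grad_x' x y \<zeta> = (\<chi> i. dird (0, \<zeta>) (dird (axis i 1, 0) F) (x, y))"

definition grad_y' :: "real^'n \<Rightarrow> real^'n \<Rightarrow> real^'n \<Rightarrow> real^'n" where
  "grad_y' y x \<xi> = (\<chi> i. dird (\<xi>, 0) (dird (0, axis i 1) F) (x, y))"

lemma has_derivative_freeze_x:
  "f differentiable (at (x, y)) \<Longrightarrow> ((\<lambda>y. f (x, y)) has_derivative (\<lambda>h. dird (0, h) f (x, y))) (at y)"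
  by (rule has_derivative_compose[OF _ has_derivative_dird, where f = "\<lambda>y. (x, y)", of "\<lambda>h. (0, h)"])
    (auto intro!: derivative_eq_intros)

lemma has_derivative_freeze_y:
  "f differentiable (at (x, y)) \<Longrightarrow> ((\<lambda>x. f (x, y)) has_derivative (\<lambda>h. dird (h, 0) f (x, y))) (at x)"
  by (rule has_derivative_compose[OF _ has_derivative_dird, where f = "\<lambda>x. (x, y)", of "\<lambda>h. (h, 0)"])
    (auto intro!: derivative_eq_intros)

lemma has_derivative_grad_x: "(grad_x c x has_derivative grad_x' x y) (at y)"
  by (rule has_derivative_vec)
    (simp add: grad_x_nth grad_x'_def has_derivative_freeze_x[OF differentiable_dF])

lemma has_derivative_grad_y: "((\<lambda>x. grad_y c x y) has_derivative grad_y' y x) (at x)"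
  by (rule has_derivative_vec)
    (simp add: grad_y_nth grad_y'_def has_derivative_freeze_y[OF differentiable_dF])

lemma differentiable_grad_x': "(\<lambda>y. grad_x' x y \<zeta>) differentiable (at y)"
  by (rule differentiableI[of _ "\<lambda>h. \<chi> i. dird (0, h) (dird (0, \<zeta>) (dird (axis i 1, 0) F)) (x, y)"],
      rule has_derivative_vec)
    (simp add: grad_x'_def has_derivative_freeze_x[OF differentiable_ddF])

lemma differentiable_grad_y': "(\<lambda>x. grad_y' y x \<xi>) differentiable (at x)"
  by (rule differentiableI[of _ "\<lambda>h. \<chi> i. dird (h, 0) (dird (\<xi>, 0) (dird (0, axis i 1) F)) (x, y)"],
      rule has_derivative_vec)
    (simp add: grad_y'_def has_derivative_freeze_y[OF differentiable_ddF])

lemma grad_x'_eq: "grad_x' x y \<zeta> = mixed_hessian x y *v \<zeta>"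
  by (simp add: grad_x'_def vec_eq_iff mixed_hessian_mult)

lemma grad_y'_eq: "grad_y' y x \<xi> = transpose (mixed_hessian x y) *v \<xi>"
  by (simp add: grad_y'_def vec_eq_iff mixed_hessian_transpose_mult del: transpose_matrix_vector)

lemma inj_grad_x': "inj (grad_x' x y)"
  using det_mixed_hessian[of x y] unfolding grad_x'_eq[abs_def]
  by (simp add: inj_matrix_vector_mult invertible_det_nz)

lemma inj_grad_y': "inj (grad_y' y x)"
  using det_mixed_hessian[of x y] unfolding grad_y'_eq[abs_def]
  by (simp add: inj_matrix_vector_mult invertible_det_nz)

lemma inner_grad_x': "grad_x' x y \<zeta> \<bullet> \<xi> = dird (0, \<zeta>) (dird (\<xi>, 0) F) (x, y)"
proof -
  have "((\<lambda>y. grad_x c x y \<bullet> \<xi>) has_derivative (\<lambda>\<zeta>. grad_x' x y \<zeta> \<bullet> \<xi>)) (at y)"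
    using has_derivative_grad_x by (rule has_derivative_inner_left)
  moreover have "((\<lambda>y. grad_x c x y \<bullet> \<xi>) has_derivative (\<lambda>\<zeta>. dird (0, \<zeta>) (dird (\<xi>, 0) F) (x, y))) (at y)"
    unfolding inner_grad_x by (rule has_derivative_freeze_x[OF differentiable_dF])
  ultimately show ?thesis by (rule has_derivative_unique[THEN fun_cong])
qed

section \<open>c-segments in either variable, extended to all real times\<close>

definition c_segment_at_x ::
    "real^'n \<Rightarrow> real^'n \<Rightarrow> real^'n \<Rightarrow> (real \<Rightarrow> real^'n) \<Rightarrow> (real \<Rightarrow> real^'n) \<Rightarrow> (real \<Rightarrow> real^'n) \<Rightarrow> bool" where
  "c_segment_at_x x p v \<gamma> \<gamma>' \<gamma>'' \<longleftrightarrow> (\<forall>t. grad_x c x (\<gamma> t) = p + t *\<^sub>R v) \<and>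
      (\<forall>t. (\<gamma> has_vector_derivative \<gamma>' t) (at t)) \<and>
      (\<forall>t. (\<gamma>' has_vector_derivative \<gamma>'' t) (at t))"

definition c_segment_at_y ::
    "real^'n \<Rightarrow> real^'n \<Rightarrow> real^'n \<Rightarrow> (real \<Rightarrow> real^'n) \<Rightarrow> (real \<Rightarrow> real^'n) \<Rightarrow> (real \<Rightarrow> real^'n) \<Rightarrow> bool" where
  "c_segment_at_y y p v \<gamma> \<gamma>' \<gamma>'' \<longleftrightarrow> (\<forall>t. grad_y c (\<gamma> t) y = p + t *\<^sub>R v) \<and>
      (\<forall>t. (\<gamma> has_vector_derivative \<gamma>' t) (at t)) \<and>
      (\<forall>t. (\<gamma>' has_vector_derivative \<gamma>'' t) (at t))"

lemma c_segment_at_x_exists: "\<exists>\<gamma> \<gamma>' \<gamma>''. c_segment_at_x x p v \<gamma> \<gamma>' \<gamma>''"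
  unfolding c_segment_at_x_def
  by (rule preimage_of_line[where P = "grad_x c x" and P' = "grad_x' x"])
    (rule bij_grad_x has_derivative_grad_x inj_grad_x' differentiable_grad_x')+

lemma c_segment_at_y_exists: "\<exists>\<gamma> \<gamma>' \<gamma>''. c_segment_at_y y p v \<gamma> \<gamma>' \<gamma>''"
  unfolding c_segment_at_y_def
  by (rule preimage_of_line[where P = "\<lambda>x. grad_y c x y" and P' = "grad_y' y"])
    (rule bij_grad_y has_derivative_grad_y inj_grad_y' differentiable_grad_y')+

text \<open>These are the first and second derivatives of the affine function
  \<open>grad_x c x (\<gamma> t) \<bullet> \<xi>\<close>. The second relation determines the
  acceleration of \<gamma> by its velocity.\<close>

lemma c_segment_at_x_dird:
  assumes "c_segment_at_x x p v \<gamma> \<gamma>' \<gamma>''"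
  shows "dird (0, \<gamma>' t) (dird (\<xi>, 0) F) (x, \<gamma> t) = v \<bullet> \<xi>"
    and "dird (0, \<gamma>' t) (dird (0, \<gamma>' t) (dird (\<xi>, 0) F)) (x, \<gamma> t)
      + dird (0, \<gamma>'' t) (dird (\<xi>, 0) F) (x, \<gamma> t) = 0"
proof -
  have 1: "(\<gamma> has_vector_derivative \<gamma>' t) (at t)" "(\<gamma>' has_vector_derivative \<gamma>'' t) (at t)"
    and 2: "dird (\<xi>, 0) F (x, \<gamma> t) = p \<bullet> \<xi> + t * (v \<bullet> \<xi>)" for t
    using assms by (simp_all add: c_segment_at_x_def inner_add_left flip: inner_grad_x)
  have C: "C_k_on 2 (dird (\<xi>, 0) F) UNIV" by (rule C_dF) simp
  show "dird (0, \<gamma>' t) (dird (\<xi>, 0) F) (x, \<gamma> t) = v \<bullet> \<xi>"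
    by (rule affine_along(1)[OF C has_vector_derivative_Pair_const(1)[OF 1(1)]
          has_vector_derivative_Pair_const(1)[OF 1(2)] 2])
  show "dird (0, \<gamma>' t) (dird (0, \<gamma>' t) (dird (\<xi>, 0) F)) (x, \<gamma> t)
      + dird (0, \<gamma>'' t) (dird (\<xi>, 0) F) (x, \<gamma> t) = 0"
    by (rule affine_along(2)[OF C has_vector_derivative_Pair_const(1)[OF 1(1)]
          has_vector_derivative_Pair_const(1)[OF 1(2)] 2])
qed

lemma c_segment_at_y_dird:
  assumes "c_segment_at_y y p v \<gamma> \<gamma>' \<gamma>''"
  shows "dird (\<gamma>' t, 0) (dird (0, \<zeta>) F) (\<gamma> t, y) = v \<bullet> \<zeta>"
    and "dird (\<gamma>' t, 0) (dird (\<gamma>' t, 0) (dird (0, \<zeta>) F)) (\<gamma> t, y)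
      + dird (\<gamma>'' t, 0) (dird (0, \<zeta>) F) (\<gamma> t, y) = 0"
proof -
  have 1: "(\<gamma> has_vector_derivative \<gamma>' t) (at t)" "(\<gamma>' has_vector_derivative \<gamma>'' t) (at t)"
    and 2: "dird (0, \<zeta>) F (\<gamma> t, y) = p \<bullet> \<zeta> + t * (v \<bullet> \<zeta>)" for t
    using assms by (simp_all add: c_segment_at_y_def inner_add_left flip: inner_grad_y)
  have C: "C_k_on 2 (dird (0, \<zeta>) F) UNIV" by (rule C_dF) simp
  show "dird (\<gamma>' t, 0) (dird (0, \<zeta>) F) (\<gamma> t, y) = v \<bullet> \<zeta>"
    by (rule affine_along(1)[OF C has_vector_derivative_Pair_const(2)[OF 1(1)]
          has_vector_derivative_Pair_const(2)[OF 1(2)] 2])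
  show "dird (\<gamma>' t, 0) (dird (\<gamma>' t, 0) (dird (0, \<zeta>) F)) (\<gamma> t, y)
      + dird (\<gamma>'' t, 0) (dird (0, \<zeta>) F) (\<gamma> t, y) = 0"
    by (rule affine_along(2)[OF C has_vector_derivative_Pair_const(2)[OF 1(1)]
          has_vector_derivative_Pair_const(2)[OF 1(2)] 2])
qed

subsection \<open>The curvature condition along \<open>c\<close>-segments\<close>

lemma A_mat_eq: "A_mat c i j x p = dird (axis j 1, 0) (dird (axis i 1, 0) F) (x, y_of c x p)"
proof -
  have "partial i (\<lambda>x. c x y) x = dird (axis i 1, 0) F (x, y)" for i x y
    using partial_fst_eq_dird[OF differentiable_F] by (simp add: F_Pair)
  then show ?thesis
    using partial_fst_eq_dird[OF differentiable_dF] by (simp add: A_mat_def Let_def)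
qed

text \<open>\<open>partial\<close> is built on \<open>deriv\<close>, whose value says nothing at a
  point of non-differentiability. With f a second x-derivative of the cost, this lemma makes the
  iterated partial derivatives of \<open>A_mat\<close> genuine ones.\<close>

lemma compose_y_of_twice_differentiable:
  assumes f: "C_k_on 2 f UNIV"
  shows "(\<lambda>p. f (x, y_of c x p)) differentiable (at p)"
    and "dird v (\<lambda>p. f (x, y_of c x p)) differentiable (at p)"
proof -
  have f': "C_k_on (Suc 1) f UNIV" using f by (simp add: numeral_2_eq_2)
  have df: "f differentiable (at z)" for z using f' by (rule C_k_on_Suc_differentiable)
  have d2: "dird u f differentiable (at z)" for u z
    using C_k_on_dird[OF f'] unfolding One_nat_def by (rule C_k_on_Suc_differentiable)
  define Q where "Q = y_of c x"
  define Q' where "Q' p = inv (grad_x' x (Q p))" for p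
  have Q_inv: "Q = inv (grad_x c x)" unfolding Q_def by (rule ext) (rule y_of_eq)
  have Q: "(Q has_derivative Q' p) (at p)" for p
    unfolding Q'_def unfolding Q_inv
    by (rule has_derivative_inv_bij[OF bij_grad_x has_derivative_grad_x inj_grad_x'])
  have Q': "(\<lambda>p. Q' p v) differentiable (at p)" for p v
    unfolding Q'_def unfolding Q_inv
    by (rule inv_derivative_differentiable[OF bij_grad_x has_derivative_grad_x inj_grad_x'
          differentiable_grad_x'])
  have comp: "((\<lambda>p. g (x, Q p)) has_derivative (\<lambda>h. dird (0, Q' p h) g (x, Q p))) (at p)"
    if "\<And>z. g differentiable (at z)" for g p
    by (rule has_derivative_compose[OF Q has_derivative_freeze_x[OF that]])
  show "(\<lambda>p. f (x, y_of c x p)) differentiable (at p)"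
    using comp[OF df] unfolding Q_def by (rule differentiableI)
  have "dird v (\<lambda>p. f (x, y_of c x p))
      = (\<lambda>p. \<Sum>b\<in>Basis. ((0, Q' p v) \<bullet> b) * dird b f (x, Q p))"
    unfolding Q_def[symmetric]
    by (rule ext) (simp only: dird_eq[OF comp[OF df]], rule dird_Basis[OF df])
  moreover have "(\<lambda>p. \<Sum>b\<in>Basis. ((0, Q' p v) \<bullet> b) * dird b f (x, Q p)) differentiable (at p)"
  proof -
    have "(\<lambda>p. dird b f (x, Q p)) differentiable (at p)" for b
      using comp[OF d2] by (rule differentiableI)
    moreover have "(\<lambda>p. (0::real^'n, Q' p v) \<bullet> b) differentiable (at p)" for b
    proof (rule differentiableI)
      have "((\<lambda>p. Q' p v) has_derivative frechet_derivative (\<lambda>p. Q' p v) (at p)) (at p)"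
        using Q' by (simp only: frechet_derivative_works)
      then show "((\<lambda>p. (0::real^'n, Q' p v) \<bullet> b) has_derivative
          (\<lambda>h. (0, frechet_derivative (\<lambda>p. Q' p v) (at p) h) \<bullet> b)) (at p)"
        by (intro has_derivative_inner_left has_derivative_Pair has_derivative_const)
    qed
    ultimately show ?thesis
      by (intro differentiable_sum finite_Basis ballI differentiable_mult)
  qed
  ultimately show "dird v (\<lambda>p. f (x, y_of c x p)) differentiable (at p)"
    by simp
qed

text \<open>By injectivity of \<open>grad_x c x\<close>, the curve \<gamma> is
  \<open>y_of c x\<close> restricted to the line \<open>p + t *\<^sub>R \<eta>\<close>. The second
  derivative of \<open>f (x, \<gamma> t)\<close> is computed once in p and once along
  \<gamma>.\<close>

lemma second_partials_along_c_segment: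
  assumes f: "C_k_on 2 f UNIV" and \<gamma>: "c_segment_at_x x p \<eta> \<gamma> \<gamma>' \<gamma>''"
  shows "(\<Sum>k\<in>UNIV. \<Sum>l\<in>UNIV. partial k (\<lambda>p. partial l (\<lambda>p. f (x, y_of c x p)) p) (p + t *\<^sub>R \<eta>)
            * (\<eta> $ k * \<eta> $ l))
    = dird (0, \<gamma>' t) (dird (0, \<gamma>' t) f) (x, \<gamma> t) + dird (0, \<gamma>'' t) f (x, \<gamma> t)"
proof -
  let ?H = "\<lambda>p. f (x, y_of c x p)"
  have df: "f differentiable (at z)" for z
    using f unfolding numeral_2_eq_2 by (rule C_k_on_Suc_differentiable)
  have \<gamma>_deriv: "(\<gamma> has_vector_derivative \<gamma>' t) (at t)" "(\<gamma>' has_vector_derivative \<gamma>'' t) (at t)" for t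
    using \<gamma> by (auto simp: c_segment_at_x_def)
  have y_of: "y_of c x (p + t *\<^sub>R \<eta>) = \<gamma> t" for t
    unfolding y_of_eq using \<gamma>
    by (intro inv_f_eq bij_is_inj[OF bij_grad_x]) (auto simp: c_segment_at_x_def)
  note H = compose_y_of_twice_differentiable[OF f, where x = x]
  have 1: "dird \<eta> ?H (p + t *\<^sub>R \<eta>) = dird (0, \<gamma>' t) f (x, \<gamma> t)" for t
  proof (rule DERIV_unique)
    show "((\<lambda>t. ?H (p + t *\<^sub>R \<eta>)) has_real_derivative dird \<eta> ?H (p + t *\<^sub>R \<eta>)) (at t)"
      by (rule has_real_derivative_along[OF H(1) has_vector_derivative_line])
    show "((\<lambda>t. ?H (p + t *\<^sub>R \<eta>)) has_real_derivative dird (0, \<gamma>' t) f (x, \<gamma> t)) (at t)"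
      unfolding y_of
      by (rule has_real_derivative_along[OF df has_vector_derivative_Pair_const(1)[OF \<gamma>_deriv(1)]])
  qed
  have "dird \<eta> (dird \<eta> ?H) (p + t *\<^sub>R \<eta>)
      = dird (0, \<gamma>' t) (dird (0, \<gamma>' t) f) (x, \<gamma> t) + dird (0, \<gamma>'' t) f (x, \<gamma> t)"
  proof (rule DERIV_unique)
    show "((\<lambda>t. dird \<eta> ?H (p + t *\<^sub>R \<eta>)) has_real_derivative
        dird \<eta> (dird \<eta> ?H) (p + t *\<^sub>R \<eta>)) (at t)"
      by (rule has_real_derivative_along[where f = "dird \<eta> ?H", OF H(2) has_vector_derivative_line])
    show "((\<lambda>t. dird \<eta> ?H (p + t *\<^sub>R \<eta>)) has_real_derivative
        dird (0, \<gamma>' t) (dird (0, \<gamma>' t) f) (x, \<gamma> t) + dird (0, \<gamma>'' t) f (x, \<gamma> t)) (at t)"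
      unfolding 1
      by (rule has_real_derivative_dird_along[OF f has_vector_derivative_Pair_const(1)[OF \<gamma>_deriv(1)]
            has_vector_derivative_Pair_const(1)[OF \<gamma>_deriv(2)]])
  qed
  then show ?thesis
    using sum_second_partials[OF H] by simp
qed

text \<open>A single sum over index pairs with constant coefficients lets further derivatives pass
  inside in one application of \<open>dird_sum_right\<close>.\<close>

lemma dird_x_twice:
  "dird (\<xi>, 0) (dird (\<xi>, 0) F) = (\<lambda>z. \<Sum>ij\<in>UNIV.
     (\<xi> $ fst ij * \<xi> $ snd ij) * dird (axis (snd ij) 1, 0) (dird (axis (fst ij) 1, 0) F) z)"
proof
  fix z
  have 1: "dird (\<xi>, 0) F = (\<lambda>z. \<Sum>i\<in>UNIV. \<xi> $ i * dird (axis i 1, 0) F z)"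
    by (rule ext, subst sum_axis_Pair_0[of \<xi>, symmetric]) (rule dird_sum_left[OF differentiable_F])
  have "dird (\<xi>, 0) (dird (\<xi>, 0) F) z = (\<Sum>i\<in>UNIV. \<xi> $ i * dird (\<xi>, 0) (dird (axis i 1, 0) F) z)"
    by (subst 1) (rule dird_sum_right[OF differentiable_dF])
  moreover have "dird (\<xi>, 0) (dird (axis i 1, 0) F) z
      = (\<Sum>j\<in>UNIV. \<xi> $ j * dird (axis j 1, 0) (dird (axis i 1, 0) F) z)" for i
    by (subst sum_axis_Pair_0[of \<xi>, symmetric]) (rule dird_sum_left[OF differentiable_dF])
  ultimately show "dird (\<xi>, 0) (dird (\<xi>, 0) F) z = (\<Sum>ij\<in>UNIV. (\<xi> $ fst ij * \<xi> $ snd ij)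
      * dird (axis (snd ij) 1, 0) (dird (axis (fst ij) 1, 0) F) z)"
    by (simp add: sum_distrib_left mult.assoc sum.cartesian_product split_def)
qed

lemma weak_A3_along_c_segment:
  assumes "weak_A3 c" and \<gamma>: "c_segment_at_x x p \<eta> \<gamma> \<gamma>' \<gamma>''" and "orthogonal \<xi> \<eta>"
  shows "dird (0, \<gamma>' t) (dird (0, \<gamma>' t) (dird (\<xi>, 0) (dird (\<xi>, 0) F))) (x, \<gamma> t)
      + dird (0, \<gamma>'' t) (dird (\<xi>, 0) (dird (\<xi>, 0) F)) (x, \<gamma> t) \<ge> 0"
proof -
  let ?f = "\<lambda>i j. dird (axis j 1, 0) (dird (axis i 1, 0) F)"
  let ?D = "\<lambda>f. dird (0, \<gamma>' t) (dird (0, \<gamma>' t) f) (x, \<gamma> t) + dird (0, \<gamma>'' t) f (x, \<gamma> t)"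
  have C: "C_k_on 2 (?f i j) UNIV" for i j by (rule C_ddF) simp
  have A: "A_mat c i j x = (\<lambda>p. ?f i j (x, y_of c x p))" for i j
    by (rule ext) (rule A_mat_eq)
  have "0 \<le> (\<Sum>i\<in>UNIV. \<Sum>j\<in>UNIV. \<Sum>k\<in>UNIV. \<Sum>l\<in>UNIV.
      partial k (\<lambda>p'. partial l (A_mat c i j x) p') (p + t *\<^sub>R \<eta>) * \<xi>$i * \<xi>$j * \<eta>$k * \<eta>$l)"
    using assms(1,3) unfolding weak_A3_def by blast
  also have "\<dots> = (\<Sum>i\<in>UNIV. \<Sum>j\<in>UNIV. (\<xi> $ i * \<xi> $ j) * (\<Sum>k\<in>UNIV. \<Sum>l\<in>UNIV.
      partial k (\<lambda>p'. partial l (\<lambda>p. ?f i j (x, y_of c x p)) p') (p + t *\<^sub>R \<eta>) * (\<eta> $ k * \<eta> $ l)))"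
    unfolding A sum_distrib_left by (intro sum.cong refl) (simp add: mult_ac)
  also have "\<dots> = (\<Sum>i\<in>UNIV. \<Sum>j\<in>UNIV. (\<xi> $ i * \<xi> $ j) * ?D (?f i j))"
    unfolding second_partials_along_c_segment[OF C \<gamma>] ..
  also have "\<dots> = (\<Sum>ij\<in>UNIV. (\<xi> $ fst ij * \<xi> $ snd ij) * ?D (?f (fst ij) (snd ij)))"
    by (simp add: sum.cartesian_product split_def)
  also have "\<dots> = ?D (dird (\<xi>, 0) (dird (\<xi>, 0) F))"
  proof -
    have 1: "dird u (dird (\<xi>, 0) (dird (\<xi>, 0) F))
        = (\<lambda>z. \<Sum>ij\<in>UNIV. (\<xi> $ fst ij * \<xi> $ snd ij) * dird u (?f (fst ij) (snd ij)) z)" for u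
      unfolding dird_x_twice by (rule ext, rule dird_sum_right[OF differentiable_ddF])
    have 2: "dird u (dird u (dird (\<xi>, 0) (dird (\<xi>, 0) F))) z
        = (\<Sum>ij\<in>UNIV. (\<xi> $ fst ij * \<xi> $ snd ij) * dird u (dird u (?f (fst ij) (snd ij))) z)" for u z
      unfolding 1 by (rule dird_sum_right[OF differentiable_dddF])
    show ?thesis
      unfolding 2 unfolding 1 by (simp only: distrib_left sum.distrib)
  qed
  finally show ?thesis .
qed

text \<open>Every \<zeta> is the velocity at y of some c-segment based at x, and \<kappa> is its
  acceleration there. The mixed Hessian carries \<zeta> to the direction \<eta> of that segment in
  p, so the hypothesis is the orthogonality of \<xi> and \<eta>.\<close>

lemma weak_A3_at:
  assumes "weak_A3 c" and orth: "dird (\<xi>, 0) (dird (0, \<zeta>) F) (x, y) = 0"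
  shows "\<exists>\<kappa>. (\<forall>v. dird (0, \<zeta>) (dird (0, \<zeta>) (dird (v, 0) F)) (x, y) + dird (0, \<kappa>) (dird (v, 0) F) (x, y) = 0)
    \<and> dird (0, \<zeta>) (dird (0, \<zeta>) (dird (\<xi>, 0) (dird (\<xi>, 0) F))) (x, y)
      + dird (0, \<kappa>) (dird (\<xi>, 0) (dird (\<xi>, 0) F)) (x, y) \<ge> 0"
proof -
  define \<eta> where "\<eta> = grad_x' x y \<zeta>"
  obtain \<gamma> \<gamma>' \<gamma>'' where \<gamma>: "c_segment_at_x x (grad_x c x y) \<eta> \<gamma> \<gamma>' \<gamma>''"
    using c_segment_at_x_exists by blast
  have "grad_x c x (\<gamma> 0) = grad_x c x y"
    using \<gamma> by (simp add: c_segment_at_x_def)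
  then have y: "\<gamma> 0 = y"
    by (rule injD[OF bij_is_inj[OF bij_grad_x]])
  have "grad_x' x y (\<gamma>' 0) \<bullet> v = \<eta> \<bullet> v" for v
    using c_segment_at_x_dird(1)[OF \<gamma>, of 0 v] by (simp add: inner_grad_x' y)
  then have "grad_x' x y (\<gamma>' 0) = grad_x' x y \<zeta>"
    unfolding \<eta>_def[symmetric] using vector_eq_rdot by blast
  then have \<zeta>: "\<gamma>' 0 = \<zeta>"
    by (rule injD[OF inj_grad_x'])
  have "orthogonal \<xi> \<eta>"
    using orth by (simp add: orthogonal_def \<eta>_def inner_commute[of \<xi>] inner_grad_x' dird_commute_F)
  from weak_A3_along_c_segment[OF assms(1) \<gamma> this, of 0] c_segment_at_x_dird(2)[OF \<gamma>, of 0]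
  show ?thesis unfolding y \<zeta> by blast
qed

section \<open>Exchanging the roles of the two variables\<close>

lemma dird_commute_F_fun: "dird u (dird v F) = dird v (dird u F)"
  by (rule ext) (rule dird_commute_F)

lemma dird_commute_dF: "dird u (dird v (dird w F)) = dird v (dird u (dird w F))"
  by (rule ext, rule dird_commute, rule C_dF) simp

lemma dird_commute_ddF: "dird u (dird v (dird w (dird r F))) = dird v (dird u (dird w (dird r F)))"
  by (rule ext, rule dird_commute, rule C_ddF) simp

text \<open>Moving two y-derivatives past two x-derivatives commutes derivatives at every order up
  to four, which is exactly the assumed smoothness of the cost.\<close>

lemma dird_commute_pairs:
  "dird u (dird u (dird v (dird v F))) = dird v (dird v (dird u (dird u F)))"
  by (metis dird_commute_F_fun dird_commute_dF dird_commute_ddF)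

text \<open>Along the \<open>c\<close>-segment \<open>\<sigma>\<close> from \<open>z0\<close> to \<open>x\<close> with respect to \<open>y\<close>, the function
  \<open>s \<mapsto> dird (0, \<zeta>) (dird (0, \<zeta>) F) (\<sigma> s, y) + dird (0, \<kappa>0) F (\<sigma> s, y)\<close> is convex, because its
  second derivative is the curvature expression of weak A3 with the roles of the two variables
  exchanged; the choice of \<open>\<kappa>0\<close> makes it stationary at \<open>s = 0\<close>.\<close>

lemma weak_A3_comparison:
  assumes "weak_A3 c"
    and \<kappa>0: "\<And>v. dird (0, \<zeta>) (dird (0, \<zeta>) (dird (v, 0) F)) (z0, y) + dird (0, \<kappa>0) (dird (v, 0) F) (z0, y) = 0"
    and orth: "dird (0, \<zeta>) F (x, y) = dird (0, \<zeta>) F (z0, y)"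
  shows "dird (0, \<zeta>) (dird (0, \<zeta>) F) (z0, y) + dird (0, \<kappa>0) F (z0, y)
    \<le> dird (0, \<zeta>) (dird (0, \<zeta>) F) (x, y) + dird (0, \<kappa>0) F (x, y)"
proof -
  define \<delta> where "\<delta> = grad_y c x y - grad_y c z0 y"
  obtain \<sigma> \<sigma>' \<sigma>'' where \<sigma>: "c_segment_at_y y (grad_y c z0 y) \<delta> \<sigma> \<sigma>' \<sigma>''"
    using c_segment_at_y_exists by blast
  have "grad_y c (\<sigma> 0) y = grad_y c z0 y" "grad_y c (\<sigma> 1) y = grad_y c x y"
    using \<sigma> by (simp_all add: c_segment_at_y_def \<delta>_def)
  then have \<sigma>01: "\<sigma> 0 = z0" "\<sigma> 1 = x"
    using injD[OF bij_is_inj[OF bij_grad_y]] by blast+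
  have \<sigma>_deriv: "((\<lambda>s. (\<sigma> s, y)) has_vector_derivative (\<sigma>' s, 0)) (at s)"
    "((\<lambda>s. (\<sigma>' s, 0::real^'n)) has_vector_derivative (\<sigma>'' s, 0)) (at s)" for s
    using \<sigma> by (auto simp: c_segment_at_y_def intro!: has_vector_derivative_Pair_const(2))
  define f where "f = dird (0, \<zeta>) (dird (0, \<zeta>) F)"
  define g where "g = dird (0, \<kappa>0) F"
  define G where "G s = f (\<sigma> s, y) + g (\<sigma> s, y)" for s
  define G' where "G' s = dird (\<sigma>' s, 0) f (\<sigma> s, y) + dird (\<sigma>' s, 0) g (\<sigma> s, y)" for s
  define G'' where "G'' s = (dird (\<sigma>' s, 0) (dird (\<sigma>' s, 0) f) (\<sigma> s, y) + dird (\<sigma>'' s, 0) f (\<sigma> s, y))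
    + (dird (\<sigma>' s, 0) (dird (\<sigma>' s, 0) g) (\<sigma> s, y) + dird (\<sigma>'' s, 0) g (\<sigma> s, y))" for s
  have Cf: "C_k_on 2 f UNIV" unfolding f_def by (rule C_ddF) simp
  have Cg: "C_k_on 2 g UNIV" unfolding g_def by (rule C_dF) simp
  have G': "(G has_real_derivative G' s) (at s)" for s
    unfolding G_def[abs_def] G'_def f_def g_def
    by (intro DERIV_add has_real_derivative_along differentiable_dF differentiable_ddF \<sigma>_deriv)
  have G'': "(G' has_real_derivative G'' s) (at s)" for s
    unfolding G'_def[abs_def] G''_def
    by (intro DERIV_add has_real_derivative_dird_along Cf Cg \<sigma>_deriv)
  have "G'' s \<ge> 0" for s
  proof -
    \<comment> \<open>The pairing equals \<open>\<delta> \<bullet> \<zeta>\<close> for every s,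
      because \<open>grad_y\<close> is affine along \<sigma>, and \<open>orth\<close> says that this
      number is zero. Thus weak A3 applies along the entire segment, with a vector \<kappa>
      depending on s.\<close>
    have "dird (\<sigma>' s, 0) (dird (0, \<zeta>) F) (\<sigma> s, y) = 0"
      using c_segment_at_y_dird(1)[OF \<sigma>] orth
      by (simp add: \<delta>_def inner_diff_left inner_grad_y)
    from weak_A3_at[OF assms(1) this] obtain \<kappa> where
      \<kappa>: "\<And>v. dird (0, \<zeta>) (dird (0, \<zeta>) (dird (v, 0) F)) (\<sigma> s, y) + dird (0, \<kappa>) (dird (v, 0) F) (\<sigma> s, y) = 0"
      and nonneg: "dird (0, \<zeta>) (dird (0, \<zeta>) (dird (\<sigma>' s, 0) (dird (\<sigma>' s, 0) F))) (\<sigma> s, y)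
        + dird (0, \<kappa>) (dird (\<sigma>' s, 0) (dird (\<sigma>' s, 0) F)) (\<sigma> s, y) \<ge> 0"
      by blast
    \<comment> \<open>This exchanges the correction terms of the two c-segments: the equation of
      \<sigma> trades two \<sigma>'-derivatives for one in direction \<sigma>'', and the equation of
      \<kappa>, tested on \<sigma>'', then trades \<kappa> for two \<zeta>-derivatives.\<close>
    have "dird (0, \<kappa>) (dird (\<sigma>' s, 0) (dird (\<sigma>' s, 0) F)) (\<sigma> s, y)
        = dird (\<sigma>' s, 0) (dird (\<sigma>' s, 0) (dird (0, \<kappa>) F)) (\<sigma> s, y)"
      by (metis dird_commute_F_fun dird_commute_dF)
    also have "\<dots> = - dird (\<sigma>'' s, 0) (dird (0, \<kappa>) F) (\<sigma> s, y)"
      using c_segment_at_y_dird(2)[OF \<sigma>, of s \<kappa>] by simp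
    also have "\<dots> = - dird (0, \<kappa>) (dird (\<sigma>'' s, 0) F) (\<sigma> s, y)"
      by (metis dird_commute_F)
    also have "\<dots> = dird (0, \<zeta>) (dird (0, \<zeta>) (dird (\<sigma>'' s, 0) F)) (\<sigma> s, y)"
      using \<kappa>[of "\<sigma>'' s"] by simp
    also have "\<dots> = dird (\<sigma>'' s, 0) f (\<sigma> s, y)"
      unfolding f_def by (metis dird_commute_F_fun dird_commute_dF)
    \<comment> \<open>The \<kappa>0-terms of \<open>G''\<close> cancel because
      \<open>dird (0, \<kappa>0) F\<close> is affine along \<sigma>; what remains is the weak A3
      expression.\<close>
    finally show ?thesis
      using nonneg c_segment_at_y_dird(2)[OF \<sigma>, of s \<kappa>0]
      by (simp add: G''_def f_def g_def dird_commute_pairs[of "(0, \<zeta>)"])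
  qed
  moreover have "G' 0 = 0"
  proof -
    have "G' 0 = dird (0, \<zeta>) (dird (0, \<zeta>) (dird (\<sigma>' 0, 0) F)) (z0, y)
        + dird (0, \<kappa>0) (dird (\<sigma>' 0, 0) F) (z0, y)"
      unfolding G'_def \<sigma>01 f_def g_def by (metis dird_commute_F_fun dird_commute_dF)
    then show ?thesis using \<kappa>0 by simp
  qed
  ultimately have "G' s \<ge> 0" if "s \<ge> 0" for s
    using DERIV_nonneg_imp_nondecreasing[of 0 s G'] G'' that by (metis)
  then have "G 0 \<le> G 1"
    using DERIV_nonneg_imp_nondecreasing[of 0 1 G] G' by (metis zero_le_one)
  then show ?thesis by (simp add: G_def \<sigma>01 f_def g_def)
qed

text \<open>Where the function \<open>\<phi>\<close> below vanishes, its \<open>t\<close>-derivative is only known to be nonnegative.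
  Moving \<open>x\<close> slightly along \<open>t \<mapsto> grad_x c x (\<gamma> t)\<close> makes the derivative strictly positive
  there, so that \<open>\<phi>\<close> can change sign only upwards.\<close>

lemma sliding_derivative_nonpos:
  assumes "weak_A3 c" and \<gamma>: "c_segment_at_x z0 p \<eta> \<gamma> \<gamma>' \<gamma>''" and "\<eta> \<noteq> 0"
  defines "\<phi> \<equiv> \<lambda>x t. dird (0, \<gamma>' t) F (x, \<gamma> t) - dird (0, \<gamma>' t) F (z0, \<gamma> t)"
  assumes "\<phi> x 1 \<le> 0" and "t0 < 1"
  shows "\<phi> x t0 \<le> 0"
proof (rule ccontr)
  assume "\<not> \<phi> x t0 \<le> 0"
  have \<gamma>1: "(\<gamma> has_vector_derivative \<gamma>' t) (at t)" and \<gamma>2: "(\<gamma>' has_vector_derivative \<gamma>'' t) (at t)" for t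
    using \<gamma> by (auto simp: c_segment_at_x_def)
  have cont_\<gamma>: "continuous_on S \<gamma>" "continuous_on S \<gamma>'" for S
    by (intro continuous_at_imp_continuous_on ballI has_vector_derivative_continuous[OF \<gamma>1]
        has_vector_derivative_continuous[OF \<gamma>2])+
  define w where "w t = grad_x c x (\<gamma> t)" for t
  define w' where "w' t = grad_x' x (\<gamma> t) (\<gamma>' t)" for t
  have w: "(w has_vector_derivative w' t) (at t)" for t
  proof -
    have "((\<lambda>t. grad_x c x (\<gamma> t)) has_derivative (\<lambda>s. grad_x' x (\<gamma> t) (s *\<^sub>R \<gamma>' t))) (at t)"
      by (rule has_derivative_compose[OF \<gamma>1[unfolded has_vector_derivative_def] has_derivative_grad_x])
    then show ?thesis
      unfolding w_def[abs_def] w'_def has_vector_derivative_def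
      using linear_cmul[OF has_derivative_linear[OF has_derivative_grad_x]] by simp
  qed
  have cont_w: "continuous_on S w" for S
    by (intro continuous_at_imp_continuous_on ballI has_vector_derivative_continuous[OF w])
  have cont_w': "continuous_on S w'" for S
    unfolding w'_def grad_x'_def
    by (intro continuous_on_vec_lambda continuous_on_dird_dird[OF C_F] continuous_on_Pair
        continuous_on_const cont_\<gamma>) simp
  have "w' t \<noteq> 0" for t
  proof
    assume "w' t = 0"
    moreover have zero: "grad_x' u y 0 = 0" for u y
      using linear_0[OF has_derivative_linear[OF has_derivative_grad_x]] .
    ultimately have "grad_x' x (\<gamma> t) (\<gamma>' t) = grad_x' x (\<gamma> t) 0"
      by (simp add: w'_def)
    then have "\<gamma>' t = 0" by (rule injD[OF inj_grad_x'])
    then have "\<eta> \<bullet> \<eta> = 0"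
      using c_segment_at_x_dird(1)[OF \<gamma>, of t \<eta>] by (simp add: zero flip: inner_grad_x')
    with \<open>\<eta> \<noteq> 0\<close> show False by simp
  qed
  \<comment> \<open>Subtracting \<open>w 1\<close> keeps \<open>X \<epsilon> 1 = x\<close>, so the
    hypothesis at time 1 survives the perturbation. \<open>H \<epsilon> t\<close> is the gain in the
    time derivative of \<phi> per unit of \<epsilon>.\<close>
  define X where "X \<epsilon> t = x + \<epsilon> *\<^sub>R (w t - w 1)" for \<epsilon> t
  define H where "H \<epsilon> t = dird (w' t, 0) (dird (0, \<gamma>' t) F) (X \<epsilon> t, \<gamma> t)" for \<epsilon> t
  have cont_H: "continuous_on UNIV (\<lambda>(\<epsilon>, t). H \<epsilon> t)"
    unfolding H_def X_def split_def
    by (intro continuous_on_dird_dird[OF C_F] continuous_on_Pair continuous_intros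
        continuous_on_compose2[OF cont_\<gamma>(1)[of UNIV]] continuous_on_compose2[OF cont_\<gamma>(2)[of UNIV]]
        continuous_on_compose2[OF cont_w[of UNIV]] continuous_on_compose2[OF cont_w'[of UNIV]] subset_UNIV) simp
  have H0: "H 0 t > 0" for t
  proof -
    \<comment> \<open>This explains the choice of w: its velocity is the image of \<gamma>' t under
      the mixed Hessian, so moving x in that direction pairs with \<gamma>' t to a square.\<close>
    have "H 0 t = w' t \<bullet> w' t"
      by (simp add: H_def X_def w'_def inner_grad_x' dird_commute_F)
    then show ?thesis using \<open>w' t \<noteq> 0\<close> by simp
  qed
  \<comment> \<open>Compactness of the time interval yields one neighbourhood of \<epsilon> = 0 that
    works for all t, as the time of the first zero depends on \<epsilon>.\<close>
  define P where "P = {z. (\<lambda>(\<epsilon>, t). H \<epsilon> t) z > 0}"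
  have "open P"
    unfolding P_def by (intro open_Collect_less continuous_on_const cont_H)
  then have "openin (prod_topology euclidean euclidean) P"
    by (simp only: prod_topology_euclidean open_openin)
  moreover have "{0} \<times> {t0..1} \<subseteq> P" using H0 by (auto simp: P_def)
  ultimately obtain E B where E: "open E" "0 \<in> E" and B: "{t0..1} \<subseteq> B" "E \<times> B \<subseteq> P"
    using tube_lemma_right[of euclidean euclidean P "{t0..1}" 0] unfolding open_openin[symmetric]
    by (metis UNIV_I compact_Icc compactin_euclidean_iff topspace_euclidean)
  have HE: "H \<epsilon> t > 0" if "\<epsilon> \<in> E" "t \<in> {t0..1}" for \<epsilon> t
  proof -
    have "(\<epsilon>, t) \<in> P" using that B by blast
    then show ?thesis by (simp add: P_def)
  qed
  define f where "f \<epsilon> t = \<phi> (X \<epsilon> t) t" for \<epsilon> t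
  define f' where "f' \<epsilon> t = (dird (\<epsilon> *\<^sub>R w' t, \<gamma>' t) (dird (0, \<gamma>' t) F) (X \<epsilon> t, \<gamma> t)
      + dird (0, \<gamma>'' t) F (X \<epsilon> t, \<gamma> t))
    - (dird (0, \<gamma>' t) (dird (0, \<gamma>' t) F) (z0, \<gamma> t) + dird (0, \<gamma>'' t) F (z0, \<gamma> t))" for \<epsilon> t
  have C2: "C_k_on 2 F UNIV" by (rule C_F) simp
  have "isCont (\<lambda>\<epsilon>. f \<epsilon> t0) 0"
  proof -
    have dF: "continuous_on UNIV (dird (0, \<gamma>' t0) F)"
      by (rule C_k_on_continuous[of 0], rule C_dF) simp
    have "continuous_on UNIV (\<lambda>\<epsilon>. f \<epsilon> t0)"
      unfolding f_def \<phi>_def X_def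
      by (intro continuous_on_diff continuous_on_const continuous_on_compose2[OF dF]
          continuous_on_Pair continuous_intros subset_UNIV)
    then show ?thesis by (simp add: continuous_on_eq_continuous_at)
  qed
  then have "((\<lambda>\<epsilon>. f \<epsilon> t0) \<longlongrightarrow> f 0 t0) (at 0)" by (simp only: isCont_def)
  then have "\<forall>\<^sub>F \<epsilon> in at 0. f \<epsilon> t0 > 0"
    using \<open>\<not> \<phi> x t0 \<le> 0\<close> by (intro order_tendstoD) (auto simp: f_def X_def)
  then have "\<forall>\<^sub>F \<epsilon> in at_right 0. f \<epsilon> t0 > 0"
    by (rule filter_leD[OF at_within_le_at])
  moreover have "\<forall>\<^sub>F \<epsilon> in at_right 0. \<epsilon> \<in> E"
    using topological_tendstoD[OF tendsto_ident_at E(1) E(2)] .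
  moreover have "\<forall>\<^sub>F \<epsilon> in at_right 0. \<epsilon> > (0::real)"
    by (rule eventually_at_right_less)
  ultimately have "\<forall>\<^sub>F \<epsilon> in at_right 0. f \<epsilon> t0 > 0 \<and> \<epsilon> \<in> E \<and> \<epsilon> > 0"
    by eventually_elim simp
  then obtain \<epsilon> where \<epsilon>: "f \<epsilon> t0 > 0" "\<epsilon> \<in> E" "\<epsilon> > 0"
    using eventually_happens'[OF trivial_limit_at_right_real] by blast
  have "(f \<epsilon> has_real_derivative f' \<epsilon> t) (at t)" for t
  proof -
    have "((\<lambda>t. X \<epsilon> t) has_vector_derivative \<epsilon> *\<^sub>R w' t) (at t)"
      unfolding X_def by (auto intro!: derivative_eq_intros w)
    then show ?thesis
      unfolding f_def[abs_def] \<phi>_def f'_def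
      by (intro DERIV_diff has_real_derivative_dird_along C2 has_vector_derivative_Pair
          has_vector_derivative_const \<gamma>1 \<gamma>2)
  qed
  moreover have "f \<epsilon> 1 \<le> 0" using assms(5) by (simp add: f_def X_def)
  ultimately obtain t where t: "t \<in> {t0..1}" "f \<epsilon> t = 0" "f' \<epsilon> t \<le> 0"
    using first_zero_nonpos_deriv[OF \<open>t0 < 1\<close>] \<epsilon>(1) by metis
  have "dird (\<epsilon> *\<^sub>R w' t, \<gamma>' t) (dird (0, \<gamma>' t) F) (X \<epsilon> t, \<gamma> t)
      = \<epsilon> * H \<epsilon> t + dird (0, \<gamma>' t) (dird (0, \<gamma>' t) F) (X \<epsilon> t, \<gamma> t)"
  proof -
    have "(\<epsilon> *\<^sub>R w' t, \<gamma>' t) = \<epsilon> *\<^sub>R (w' t, 0) + (0, \<gamma>' t)" by simp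
    then show ?thesis
      by (simp only: dird_add_left[OF differentiable_dF] dird_scale_left[OF differentiable_dF] H_def)
  qed
  \<comment> \<open>The comparison is made at the displaced point \<open>X \<epsilon> t\<close>,
    with \<gamma>'' t as \<kappa>0; the equation of \<gamma> at z0 is the stationarity condition,
    and the zero of \<open>f \<epsilon>\<close> at t is the orthogonality condition.\<close>
  moreover have "dird (0, \<gamma>' t) (dird (0, \<gamma>' t) F) (z0, \<gamma> t) + dird (0, \<gamma>'' t) F (z0, \<gamma> t)
      \<le> dird (0, \<gamma>' t) (dird (0, \<gamma>' t) F) (X \<epsilon> t, \<gamma> t) + dird (0, \<gamma>'' t) F (X \<epsilon> t, \<gamma> t)"
    by (rule weak_A3_comparison[OF assms(1) c_segment_at_x_dird(2)[OF \<gamma>]])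
      (use t(2) in \<open>simp add: f_def \<phi>_def\<close>)
  moreover have "\<epsilon> * H \<epsilon> t > 0"
    using HE[OF \<epsilon>(2) t(1)] \<epsilon>(3) by simp
  ultimately show False using t(3) by (simp add: f'_def)
qed

lemma c_segment_cost_monotone:
  assumes "weak_A3 c" and \<gamma>: "c_segment_at_x z0 p \<eta> \<gamma> \<gamma>' \<gamma>''" and "\<eta> \<noteq> 0"
    and 1: "dird (0, \<gamma>' 1) F (x, \<gamma> 1) \<le> dird (0, \<gamma>' 1) F (z0, \<gamma> 1)"
  shows "c x (\<gamma> 1) - c z0 (\<gamma> 1) \<le> c x (\<gamma> 0) - c z0 (\<gamma> 0)"
proof -
  let ?g = "\<lambda>t. F (x, \<gamma> t) - F (z0, \<gamma> t)"
  let ?\<phi> = "\<lambda>t. dird (0, \<gamma>' t) F (x, \<gamma> t) - dird (0, \<gamma>' t) F (z0, \<gamma> t)"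
  have \<gamma>1: "(\<gamma> has_vector_derivative \<gamma>' t) (at t)" for t
    using \<gamma> by (auto simp: c_segment_at_x_def)
  have "(?g has_real_derivative ?\<phi> t) (at t)" for t
    by (intro DERIV_diff has_real_derivative_along differentiable_F has_vector_derivative_Pair_const(1) \<gamma>1)
  moreover have "?\<phi> t \<le> 0" if "t \<le> 1" for t
    using sliding_derivative_nonpos[OF assms(1-3), of x t] 1 that by (cases "t = 1") auto
  ultimately have "?g 1 \<le> ?g 0"
    by (intro DERIV_nonpos_imp_nonincreasing[of 0 1 ?g] zero_le_one exI conjI)
  then show ?thesis by (simp add: F_Pair)
qed

subsection \<open>Supporting functionals and tangency\<close>

lemma tendsto_grad_y:
  assumes "(y \<longlongrightarrow> y0) A"
  shows "((\<lambda>n. grad_y c x (y n)) \<longlongrightarrow> grad_y c x y0) A"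
proof (rule vec_tendstoI)
  fix i
  have "isCont (dird (0, axis i 1) F) (x, y0)"
    using differentiable_dF by (rule differentiable_imp_continuous_within)
  then show "((\<lambda>n. grad_y c x (y n) $ i) \<longlongrightarrow> grad_y c x y0 $ i) A"
    unfolding grad_y_nth
    by (rule isCont_tendsto_compose) (intro tendsto_Pair tendsto_const assms)
qed

text \<open>Injectivity of the gradient keeps the image of z0 outside the convex image of U, so
  separation applies without any description of the boundary of that image. The normalisation
  prepares a compactness argument.\<close>

lemma c_convex_supporting_functional:
  assumes "c_convex_wrt c U V" "U \<noteq> {}" "z0 \<notin> U" "y \<in> V"
  shows "\<exists>e. norm e = 1 \<and> (\<forall>x\<in>U. grad_y c x y \<bullet> e \<le> grad_y c z0 y \<bullet> e)"
proof -
  have "grad_y c z0 y \<notin> (\<lambda>x. grad_y c x y) ` U"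
    using injD[OF bij_is_inj[OF bij_grad_y]] \<open>z0 \<notin> U\<close> by blast
  then have "\<exists>e b. e \<noteq> 0 \<and> (\<forall>q\<in>(\<lambda>x. grad_y c x y) ` U. e \<bullet> q \<le> b) \<and> (\<forall>q\<in>{grad_y c z0 y}. e \<bullet> q \<ge> b)"
    using assms by (intro separating_hyperplane_sets) (auto simp: c_convex_wrt_def)
  then obtain e b where e: "e \<noteq> 0" "\<And>x. x \<in> U \<Longrightarrow> e \<bullet> grad_y c x y \<le> b" "b \<le> e \<bullet> grad_y c z0 y"
    by auto
  then have "e \<bullet> grad_y c x y \<le> e \<bullet> grad_y c z0 y" if "x \<in> U" for x
    using that order_trans by blast
  then show ?thesis
    using e(1) by (intro exI[of _ "e /\<^sub>R norm e"])
      (auto simp: inner_commute[of _ e] intro!: mult_left_mono)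
qed

text \<open>Unit functionals at points of V tending to y0 accumulate at a unit functional, and the
  non-strict inequalities pass to the limit by continuity of \<open>grad_y\<close> in y.\<close>

lemma c_convex_supporting_functional_closure:
  assumes "c_convex_wrt c U V" "U \<noteq> {}" "z0 \<notin> U" "y0 \<in> closure V"
  shows "\<exists>e. norm e = 1 \<and> (\<forall>x\<in>U. grad_y c x y0 \<bullet> e \<le> grad_y c z0 y0 \<bullet> e)"
proof -
  obtain y where y: "\<And>n. y n \<in> V" "y \<longlonglongrightarrow> y0"
    using assms(4) unfolding closure_sequential by blast
  have "\<exists>e. \<forall>n. e n \<in> sphere 0 1 \<and> (\<forall>x\<in>U. grad_y c x (y n) \<bullet> e n \<le> grad_y c z0 (y n) \<bullet> e n)"
    using c_convex_supporting_functional[OF assms(1-3) y(1)] by (intro choice allI) simp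
  then obtain e where e: "\<And>n. e n \<in> sphere 0 1"
    "\<And>n x. x \<in> U \<Longrightarrow> grad_y c x (y n) \<bullet> e n \<le> grad_y c z0 (y n) \<bullet> e n" by blast
  obtain e0 r where r: "e0 \<in> sphere 0 1" "strict_mono r" "(e \<circ> r) \<longlonglongrightarrow> e0"
    using compact_sphere[of "0 :: real^'n" 1] e(1) unfolding compact_def by metis
  have lim: "(\<lambda>n. grad_y c x (y (r n)) \<bullet> e (r n)) \<longlonglongrightarrow> grad_y c x y0 \<bullet> e0" for x
    using r(3) LIMSEQ_subseq_LIMSEQ[OF y(2) r(2)]
    by (intro tendsto_inner tendsto_grad_y) (simp_all add: o_def)
  have "grad_y c x y0 \<bullet> e0 \<le> grad_y c z0 y0 \<bullet> e0" if "x \<in> U" for x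
    using e(2)[OF that] by (intro LIMSEQ_le[OF lim lim]) auto
  with r(1) show ?thesis by auto
qed

section \<open>Normals at the point of tangency and the conclusion on the sublevel side\<close>

lemma has_derivative_cost:
  "((\<lambda>x. c x y) has_derivative (\<lambda>v. grad_x c x y \<bullet> v)) (at x)"
  using has_derivative_freeze_y[OF differentiable_F, of y x] by (simp add: F_Pair inner_grad_x)

lemma inside_sublevel_region:
  assumes A3: "weak_A3 c" and "open U" "U \<noteq> {}" and smooth: "smooth_boundary U"
    and conv: "c_convex_wrt c U V" and y0: "y0 \<in> closure V" and "y0 \<noteq> y1"
    and tangent: "internally_tangent (N_surf c y0 y1 a) {x. c x y0 < c x y1 + a} (frontier U) U z0"
  shows "U \<subseteq> {x. c x y0 < c x y1 + a}"
proof -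
  define h where "h x = c x y0 - c x y1 - a" for x
  define T where "T = tangent_space (frontier U) z0"
  define \<eta> where "\<eta> = grad_x c z0 y0 - grad_x c z0 y1"
  have h': "(h has_derivative (\<lambda>v. (grad_x c x y0 - grad_x c x y1) \<bullet> v)) (at x)" for x
    unfolding h_def[abs_def] inner_diff_left
    using has_derivative_diff[OF has_derivative_diff[OF has_derivative_cost[of y0 x]
        has_derivative_cost[of y1 x]] has_derivative_const[of a]] by simp
  have N: "N_surf c y0 y1 a = {x. h x = 0}"
    by (auto simp: N_surf_def h_def)
  obtain \<nu> where z0: "h z0 = 0" "z0 \<in> frontier U" and T: "tangent_space {x. h x = 0} z0 = T"
    and \<nu>: "norm \<nu> = 1" "\<And>v. v \<in> T \<Longrightarrow> \<nu> \<bullet> v = 0"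
      "\<forall>\<^sub>F t in at_right 0. z0 + t *\<^sub>R \<nu> \<notin> closure {x. c x y0 < c x y1 + a}"
      "\<forall>\<^sub>F t in at_right 0. z0 + t *\<^sub>R \<nu> \<notin> closure U"
    using tangent
    unfolding internally_tangent_def outward_unit_normal_def N T_def orthogonal_def by blast
  have grad_ne: "grad_x c x y0 \<noteq> grad_x c x y1" for x
    using injD[OF bij_is_inj[OF bij_grad_x]] \<open>y0 \<noteq> y1\<close> by blast
  then have "\<eta> \<noteq> 0" by (simp add: \<eta>_def)
  then have \<eta>\<eta>: "\<eta> \<bullet> \<eta> > 0" by simp
  have cont_h: "continuous_on UNIV h"
    by (intro continuous_at_imp_continuous_on ballI has_derivative_continuous[OF h'])
  have in_T: "v \<in> T" if "\<eta> \<bullet> v = 0" for v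
    using tangent_space_level_set[OF cont_h h' z0(1)] \<open>\<eta> \<noteq> 0\<close> that unfolding T \<eta>_def by blast
  have "z0 \<notin> U" "z0 \<in> closure U"
    using z0(2) \<open>open U\<close> by (auto simp: frontier_def interior_open)

  define l where "l = \<eta> \<bullet> \<nu> / (\<eta> \<bullet> \<eta>)"
  have \<nu>_eq: "\<nu> = l *\<^sub>R \<eta>"
  proof -
    have "\<nu> \<bullet> v = (l *\<^sub>R \<eta>) \<bullet> v" for v
      using linear_functional_kernel[of "\<lambda>v. \<nu> \<bullet> v" \<eta> v] \<open>\<eta> \<noteq> 0\<close> \<nu>(2)[OF in_T]
      by (simp add: l_def linear_iff inner_add_right inner_commute[of \<nu> \<eta>] mult.commute)
    then show ?thesis using vector_eq_rdot by blast
  qed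
  \<comment> \<open>If \<nu> were a negative multiple of the gradient of h, moving along it would
    decrease h and enter the region, although \<nu> points out of it.\<close>
  have "l > 0"
  proof (rule ccontr)
    assume "\<not> l > 0"
    moreover have "l \<noteq> 0" using \<nu>(1) \<nu>_eq by auto
    ultimately have "\<eta> \<bullet> \<nu> < 0" using \<eta>\<eta> by (simp add: \<nu>_eq mult_less_0_iff)
    then have "\<forall>\<^sub>F t in at_right 0. h (z0 + t *\<^sub>R \<nu>) < h z0"
      unfolding \<eta>_def by (rule eventually_less_in_direction[OF h'])
    with \<nu>(3) have "\<forall>\<^sub>F t in at_right (0::real). False"
    proof eventually_elim
      case (elim t)
      then have "z0 + t *\<^sub>R \<nu> \<in> {x. c x y0 < c x y1 + a}" using z0(1) by (simp add: h_def)
      from subsetD[OF closure_subset this] elim(1) show False by contradiction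
    qed
    then show False by simp
  qed

  \<comment> \<open>The normal \<nu> is known to leave the closure of U, but this alone does not
    make the opposite direction enter U. The local defining function \<rho> supplies that, once its
    differential is seen to be a positive multiple of \<eta>.\<close>
  have inward: "\<forall>\<^sub>F t in at_right 0. z0 + t *\<^sub>R (- \<eta>) \<in> U"
  proof -
    obtain W \<rho> where W: "open W" "z0 \<in> W" and C\<rho>: "\<And>k. C_k_on k \<rho> W"
      and \<rho>_ne: "frechet_derivative \<rho> (at z0) \<noteq> (\<lambda>_. 0)" and UW: "U \<inter> W = {x\<in>W. \<rho> x < 0}"
      using smooth z0(2) unfolding smooth_boundary_def by blast
    have \<rho>_diff: "\<rho> differentiable (at x)" if "x \<in> W" for x
      using C\<rho>[of "Suc 0"] that by simp
    define \<rho>' where "\<rho>' = frechet_derivative \<rho> (at z0)"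
    have \<rho>': "(\<rho> has_derivative \<rho>') (at z0)"
      unfolding \<rho>'_def using \<rho>_diff[OF W(2)] by (simp only: frechet_derivative_works)
    have \<rho>0: "\<rho> x = 0" if x: "x \<in> frontier U" "x \<in> W" for x
    proof (rule antisym)
      have "x \<notin> U" using x(1) \<open>open U\<close> by (auto simp: frontier_def interior_open)
      then show "0 \<le> \<rho> x" using UW x(2) by force
      show "\<rho> x \<le> 0"
      proof (rule ccontr)
        assume "\<not> \<rho> x \<le> 0"
        have "(\<rho> \<longlongrightarrow> \<rho> x) (nhds x)"
          using differentiable_imp_continuous_within[OF \<rho>_diff[OF x(2)]]
          by (simp add: continuous_at tendsto_at_iff_tendsto_nhds)
        then have "\<forall>\<^sub>F y in nhds x. \<rho> y > 0"
          using \<open>\<not> \<rho> x \<le> 0\<close> by (intro order_tendstoD) auto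
        moreover have "\<forall>\<^sub>F y in nhds x. y \<in> W"
          using W(1) x(2) by (rule eventually_nhds_in_open)
        ultimately have "\<forall>\<^sub>F y in nhds x. y \<notin> U"
          by eventually_elim (use UW in force)
        then obtain B where "open B" "x \<in> B" "\<And>y. y \<in> B \<Longrightarrow> y \<notin> U"
          unfolding eventually_nhds by blast
        moreover have "x \<in> closure U" using x(1) by (simp add: frontier_def)
        ultimately show False using open_Int_closure_eq_empty[of B U] by blast
      qed
    qed
    \<comment> \<open>Here the tangency is used: a vector orthogonal to \<eta> is tangent to the
      level set of h, hence to the boundary of U, on which \<rho> vanishes near z0.\<close>
    have "\<rho>' v = 0" if "\<eta> \<bullet> v = 0" for v
      using tangent_space_local_max[OF \<rho>' W _ in_T[OF that, unfolded T_def]] \<rho>0 z0(2) W(2) by simp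
    then have \<rho>'_eq: "\<rho>' v = (\<eta> \<bullet> v) / (\<eta> \<bullet> \<eta>) * \<rho>' \<eta>" for v
      by (rule linear_functional_kernel[OF has_derivative_linear[OF \<rho>'] \<open>\<eta> \<noteq> 0\<close>])
    have "\<rho>' \<eta> \<noteq> 0"
    proof
      assume "\<rho>' \<eta> = 0"
      then have "\<rho>' v = 0" for v by (subst \<rho>'_eq) simp
      then have "\<rho>' = (\<lambda>_. 0)" by (rule ext)
      with \<rho>_ne show False by (simp add: \<rho>'_def)
    qed
    have enter: "\<forall>\<^sub>F t in at_right 0. z0 + t *\<^sub>R v \<in> U" if "\<rho>' v < 0" for v
      using eventually_less_in_direction[OF \<rho>' that] eventually_in_direction[OF W, of v]
    proof eventually_elim
      case (elim t)
      then have "z0 + t *\<^sub>R v \<in> {x\<in>W. \<rho> x < 0}" using \<rho>0[OF z0(2) W(2)] by simp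
      then show ?case using UW by blast
    qed
    have "\<rho>' \<eta> > 0"
    proof (rule ccontr)
      assume "\<not> \<rho>' \<eta> > 0"
      with \<open>\<rho>' \<eta> \<noteq> 0\<close> have "\<rho>' \<eta> < 0" by simp
      moreover have "\<rho>' \<nu> = l * \<rho>' \<eta>"
        unfolding \<nu>_eq using linear_cmul[OF has_derivative_linear[OF \<rho>']] by simp
      ultimately have "\<rho>' \<nu> < 0"
        using \<open>l > 0\<close> by (simp add: mult_pos_neg)
      from enter[OF this] \<nu>(4) have "\<forall>\<^sub>F t in at_right (0::real). False"
        by eventually_elim (use closure_subset[of U] in auto)
      then show False by simp
    qed
    then have "\<rho>' (- \<eta>) < 0"
      using linear_neg[OF has_derivative_linear[OF \<rho>']] by simp
    then show ?thesis by (rule enter)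
  qed

  obtain e where e: "norm e = 1" "\<And>x. x \<in> U \<Longrightarrow> grad_y c x y0 \<bullet> e \<le> grad_y c z0 y0 \<bullet> e"
    using c_convex_supporting_functional_closure[OF conv \<open>U \<noteq> {}\<close> \<open>z0 \<notin> U\<close> y0] by blast
  define \<psi> where "\<psi> x = dird (0, e) F (x, y0)" for x
  have \<psi>_U: "\<psi> x \<le> \<psi> z0" if "x \<in> U" for x
    using e(2)[OF that] by (simp add: \<psi>_def inner_grad_y)
  \<comment> \<open>By symmetry of the mixed second derivatives, \<omega> is the gradient of \<psi>
    at z0. This links the supporting functional e to a normal in x-space.\<close>
  define \<omega> where "\<omega> = grad_x' z0 y0 e"
  have \<psi>': "(\<psi> has_derivative (\<lambda>v. dird (v, 0) (dird (0, e) F) (x, y0))) (at x)" for x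
    unfolding \<psi>_def[abs_def] by (rule has_derivative_freeze_y[OF differentiable_dF])
  then have \<psi>'0: "(\<psi> has_derivative (\<lambda>v. \<omega> \<bullet> v)) (at z0)"
    unfolding \<omega>_def inner_grad_x' dird_commute_F[of "(0, e)"] .
  have cont_\<psi>: "continuous_on S \<psi>" for S
    by (intro continuous_at_imp_continuous_on ballI has_derivative_continuous[OF \<psi>'])
  have \<psi>_closure: "\<psi> x \<le> \<psi> z0" if "x \<in> closure U" for x
    using continuous_le_on_closure[OF cont_\<psi> that \<psi>_U] .
  \<comment> \<open>On the boundary of U the function \<psi> is maximal at z0, so its differential
    kills the tangent space there.\<close>
  have \<omega>_kernel: "\<omega> \<bullet> v = 0" if "\<eta> \<bullet> v = 0" for v
    by (rule tangent_space_local_max[OF \<psi>'0 open_UNIV UNIV_I _ in_T[OF that, unfolded T_def]])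
      (simp add: \<psi>_closure frontier_def)
  have \<omega>: "\<omega> \<bullet> v = (\<eta> \<bullet> v) / (\<eta> \<bullet> \<eta>) * (\<omega> \<bullet> \<eta>)" for v
    by (rule linear_functional_kernel[OF has_derivative_linear[OF \<psi>'0] \<open>\<eta> \<noteq> 0\<close> \<omega>_kernel])
  define m where "m = \<omega> \<bullet> \<eta> / (\<eta> \<bullet> \<eta>)"
  have \<omega>_eq: "\<omega> = m *\<^sub>R \<eta>"
  proof -
    have "\<omega> \<bullet> v = (m *\<^sub>R \<eta>) \<bullet> v" for v using \<omega>[of v] by (simp add: m_def)
    then show ?thesis using vector_eq_rdot by blast
  qed
  have lin: "linear (grad_x' z0 y0)"
    by (rule has_derivative_linear[OF has_derivative_grad_x])
  have "m \<noteq> 0"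
  proof
    assume "m = 0"
    then have "grad_x' z0 y0 e = grad_x' z0 y0 0"
      using \<omega>_eq linear_0[OF lin] by (simp add: \<omega>_def)
    then have "e = 0" by (rule injD[OF inj_grad_x'])
    with e(1) show False by simp
  qed
  \<comment> \<open>Otherwise \<psi> would increase strictly in the direction opposite to \<eta>,
    which enters U, where \<psi> is at most \<psi> z0.\<close>
  have "m > 0"
  proof (rule ccontr)
    assume "\<not> m > 0"
    with \<open>m \<noteq> 0\<close> have "m < 0" by simp
    have "((\<lambda>x. - \<psi> x) has_derivative (\<lambda>v. - (\<omega> \<bullet> v))) (at z0)"
      using \<psi>'0 by (rule has_derivative_minus)
    moreover have "- (\<omega> \<bullet> (- \<eta>)) < 0"
      using \<open>m < 0\<close> \<eta>\<eta> by (simp add: \<omega>_eq mult_neg_pos)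
    ultimately have "\<forall>\<^sub>F t in at_right 0. - \<psi> (z0 + t *\<^sub>R (- \<eta>)) < - \<psi> z0"
      by (rule eventually_less_in_direction)
    with inward have "\<forall>\<^sub>F t in at_right (0::real). False"
      by eventually_elim (use \<psi>_U in force)
    then show False by simp
  qed

  obtain \<gamma> \<gamma>' \<gamma>'' where \<gamma>: "c_segment_at_x z0 (grad_x c z0 y1) \<eta> \<gamma> \<gamma>' \<gamma>''"
    using c_segment_at_x_exists by blast
  have "grad_x c z0 (\<gamma> 0) = grad_x c z0 y1" "grad_x c z0 (\<gamma> 1) = grad_x c z0 y0"
    using \<gamma> by (simp_all add: c_segment_at_x_def \<eta>_def)
  then have \<gamma>01: "\<gamma> 0 = y1" "\<gamma> 1 = y0"
    using injD[OF bij_is_inj[OF bij_grad_x]] by blast+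
  have "grad_x' z0 y0 (\<gamma>' 1) \<bullet> v = \<eta> \<bullet> v" for v
    using c_segment_at_x_dird(1)[OF \<gamma>, of 1 v] by (simp add: inner_grad_x' \<gamma>01)
  then have "grad_x' z0 y0 (\<gamma>' 1) = \<eta>"
    using vector_eq_rdot by blast
  \<comment> \<open>The mixed Hessian at (z0, y0) sends e to \<open>m *\<^sub>R \<eta>\<close> and
    \<gamma>' 1 to \<eta>. Its injectivity identifies the supporting functional with the velocity of
    the c-segment at its end y0.\<close>
  then have "grad_x' z0 y0 e = grad_x' z0 y0 (m *\<^sub>R \<gamma>' 1)"
    using \<omega>_eq linear_cmul[OF lin] by (simp add: \<omega>_def)
  then have e_eq: "e = m *\<^sub>R \<gamma>' 1"
    by (rule injD[OF inj_grad_x'])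
  have h_U: "h x \<le> 0" if "x \<in> U" for x
  proof -
    have "m * (grad_y c x y0 \<bullet> \<gamma>' 1) \<le> m * (grad_y c z0 y0 \<bullet> \<gamma>' 1)"
      using e(2)[OF that] by (simp add: e_eq)
    then have "dird (0, \<gamma>' 1) F (x, \<gamma> 1) \<le> dird (0, \<gamma>' 1) F (z0, \<gamma> 1)"
      using \<open>m > 0\<close> by (simp add: \<gamma>01 flip: inner_grad_y)
    from c_segment_cost_monotone[OF A3 \<gamma> \<open>\<eta> \<noteq> 0\<close> this] show ?thesis
      using z0(1) by (simp add: h_def \<gamma>01)
  qed
  have "h x < 0" if "x \<in> U" for x
  proof (rule ccontr)
    assume "\<not> h x < 0"
    with h_U[OF that] have "h x = 0" by simp
    then have "(\<lambda>v. (grad_x c x y0 - grad_x c x y1) \<bullet> v) = (\<lambda>v. 0)"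
      using h_U by (intro differential_zero_maxmin[OF that \<open>open U\<close> h']) auto
    then have "(grad_x c x y0 - grad_x c x y1) \<bullet> (grad_x c x y0 - grad_x c x y1) = 0"
      by meson
    then show False using grad_ne[of x] by simp
  qed
  then show ?thesis by (simp add: h_def subset_iff diff_less_eq add.commute)
qed

end

theorem theorem3p1:
  fixes c :: "real^'n \<Rightarrow> real^'n \<Rightarrow> real"
    and U V R :: "(real^'n) set"
    and y0 y1 z0 :: "real^'n"
    and a :: real
  assumes "C_k_on 4 (\<lambda>(x, y). c x y) UNIV"
    and "A1 c" and "A2 c" and "weak_A3 c"
    and "open U" and "connected U" and "U \<noteq> {}" and "bounded U" and "convex U"
    and "smooth_boundary U"
    and "open V" and "connected V" and "V \<noteq> {}" and "bounded V" and "convex V"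
    and "smooth_boundary V"
    and "c_convex_wrt c U V"
    and "\<And>y y' b. y \<in> closure V \<Longrightarrow> y' \<in> closure V \<Longrightarrow> y \<noteq> y' \<Longrightarrow>
           N_surf c y y' b \<noteq> {} \<Longrightarrow> N_convex c y y' b"
    and "y0 \<in> closure V" and "y1 \<in> closure V" and "y0 \<noteq> y1"
    and "convex_region_of_N c y0 y1 a R"
    and "internally_tangent (N_surf c y0 y1 a) R (frontier U) U z0"
  shows "U \<subseteq> R"
proof -
  interpret smooth_cost c
    using assms(1-3) by unfold_locales
  note inside = inside_sublevel_region[OF \<open>weak_A3 c\<close> \<open>open U\<close> \<open>U \<noteq> {}\<close> \<open>smooth_boundary U\<close>
      \<open>c_convex_wrt c U V\<close>]
  consider "R = {x. c x y0 > c x y1 + a}" | "R = {x. c x y0 < c x y1 + a}"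
    using \<open>convex_region_of_N c y0 y1 a R\<close> unfolding convex_region_of_N_def by blast
  then show ?thesis
  proof cases
    \<comment> \<open>Exchanging y0 and y1 and negating a preserves the hypersurface and turns this
      side into a sublevel side. The supporting functional is then taken at y1, which also lies in
      the closure of V.\<close>
    case 1
    then have R: "R = {x. c x y1 < c x y0 + - a}" by auto
    have N: "N_surf c y0 y1 a = N_surf c y1 y0 (- a)" by (auto simp: N_surf_def)
    have "internally_tangent (N_surf c y1 y0 (- a)) {x. c x y1 < c x y0 + - a} (frontier U) U z0"
      using assms(23) by (simp only: R N)
    with assms(20,21) show ?thesis unfolding R by (intro inside) auto
  next
    case 2
    with assms(19,21,23) show ?thesis by (simp add: inside)
  qed
qed

end
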